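(* The quantitative emptiness problem for PosDisc and the quantitative universality problem for AsDisc are decidable. That is, there is an algorithm that, given a probabilistic weighted automaton $A$ over $\Sigma$ with rational data, a discount factor $\lambda\in(0,1)\cap\mathbb Q$ and a rational $\nu$, decides whether there is $w\in\Sigma^\omega$ with $L^{>0}_A(w)\ge\nu$; and one that decides whether $L^{=1}_A(w)\ge\nu$ for all $w\in\Sigma^\omega$; here the value function is $\mathsf{Disc}_\lambda$.
   Context: A probabilistic weighted automaton over a finite alphabet $\Sigma$ is a tuple $A=(Q,\rho_I,\Sigma,\delta,\gamma)$ where $Q$ is a finite set of states, $\rho_I$ is a probability distribution on $Q$, $\delta:Q\times\Sigma\to\mathcal D(Q)$ assigns to each state and letter a probability distribution on $Q$, and $\gamma:Q\times\Sigma\times Q\to\mathbb Q$ is a weight function. A run over an infinite word $w=\sigma_1\sigma_2\dots$ is a sequence $r=q_0\sigma_1q_1\sigma_2\dots$ with $\rho_I(q_0)>0$ and $\delta(q_i,\sigma_{i+1})(q_{i+1})>0$ for all $i$; its weight sequence is $\gamma(r)=v_0v_1\dots$ with $v_i=\gamma(q_i,\sigma_{i+1},q_{i+1})$. For each $w$, the probabilities of finite run prefixes $\rho_I(q_0)\prod_{i=1}^k\delta(q_{i-1},\sigma_i)(q_i)$ induce a probability measure $\mathbb P^A$ on runs over $w$. With $\mathsf{Disc}_\lambda(v)=\sum_{i\ge0}\lambda^iv_i$, the positive semantics is $L^{>0}_A(w)=\sup\{\eta\mid \mathbb P^A(\{r:\mathsf{Disc}_\lambda(\gamma(r))\ge\eta\})>0\}$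 and the almost-sure semantics is $L^{=1}_A(w)=\sup\{\eta\mid \mathbb P^A(\{r:\mathsf{Disc}_\lambda(\gamma(r))\ge\eta\})=1\}$. PosDisc and AsDisc denote the classes of $\mathsf{Disc}$-automata under positive and almost-sure semantics. *)

theory Defs
  imports "HOL-Probability.Probability" "HOL-Library.Nat_Bijection"
begin

datatype cm_instr = Inc nat nat | Dec nat nat nat

type_synonym cm_config = "nat \<times> (nat \<Rightarrow> nat)"

definition cm_step :: "cm_instr list \<Rightarrow> cm_config \<Rightarrow> cm_config" where
  "cm_step P c = (case c of (pc, R) \<Rightarrow>
     if pc < length P then
       (case P ! pc of
          Inc r j \<Rightarrow> (j, R(r := Suc (R r)))
        | Dec r j l \<Rightarrow> (if R r = 0 then (l, R) else (j, R(r := R r - 1))))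
     else (pc, R))"

definition cm_halted :: "cm_instr list \<Rightarrow> cm_config \<Rightarrow> bool" where
  "cm_halted P c \<longleftrightarrow> length P \<le> fst c"

definition cm_decides :: "cm_instr list \<Rightarrow> nat set \<Rightarrow> bool" where
  "cm_decides P S \<longleftrightarrow> (\<forall>x. \<exists>t. cm_halted P ((cm_step P ^^ t) (0, (\<lambda>_. 0)(0 := x))) \<and>
       snd ((cm_step P ^^ t) (0, (\<lambda>_. 0)(0 := x))) 0 = (if x \<in> S then 1 else 0))"

definition decidable :: "nat set \<Rightarrow> bool" where
  "decidable S \<longleftrightarrow> (\<exists>P. cm_decides P S)"

text \<open>(n, k, init, delta, gamma): states {0..<n}, alphabet {0..<k},
  init ! q = rho_I(q), delta ! q ! a ! q' = delta(q,a)(q'), gamma ! q ! a ! q' = gamma(q,a,q').\<close>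
type_synonym pwa = "nat \<times> nat \<times> rat list \<times> rat list list list \<times> rat list list list"

fun pwa_n :: "pwa \<Rightarrow> nat" where "pwa_n (n, k, i, d, g) = n"
fun pwa_k :: "pwa \<Rightarrow> nat" where "pwa_k (n, k, i, d, g) = k"

fun pwa_init :: "pwa \<Rightarrow> nat \<Rightarrow> real" where
  "pwa_init (n, k, i, d, g) q = (if q < n then real_of_rat (i ! q) else 0)"
fun pwa_delta :: "pwa \<Rightarrow> nat \<Rightarrow> nat \<Rightarrow> nat \<Rightarrow> real" where
  "pwa_delta (n, k, i, d, g) q a q' =
     (if q < n \<and> a < k \<and> q' < n then real_of_rat (d ! q ! a ! q') else 0)"
fun pwa_gamma :: "pwa \<Rightarrow> nat \<Rightarrow> nat \<Rightarrow> nat \<Rightarrow> real" where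
  "pwa_gamma (n, k, i, d, g) q a q' =
     (if q < n \<and> a < k \<and> q' < n then real_of_rat (g ! q ! a ! q') else 0)"

fun pwa_valid :: "pwa \<Rightarrow> bool" where
  "pwa_valid (n, k, i, d, g) \<longleftrightarrow>
     length i = n \<and> (\<forall>q<n. 0 \<le> i ! q) \<and> (\<Sum>q<n. i ! q) = 1 \<and>
     length d = n \<and> (\<forall>q<n. length (d ! q) = k \<and> (\<forall>a<k. length (d ! q ! a) = n \<and>
        (\<forall>q'<n. 0 \<le> d ! q ! a ! q') \<and> (\<Sum>q'<n. d ! q ! a ! q') = 1)) \<and>
     length g = n \<and> (\<forall>q<n. length (g ! q) = k \<and> (\<forall>a<k. length (g ! q ! a) = n))"

text \<open>Probability of a finite run prefix q0 sigma1 q1 ... sigmam qm over word w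
  (w !! i is the letter sigma_(i+1)).\<close>
definition prefix_prob :: "pwa \<Rightarrow> nat stream \<Rightarrow> nat list \<Rightarrow> real" where
  "prefix_prob A w qs = pwa_init A (hd qs) *
     (\<Prod>i<length qs - 1. pwa_delta A (qs ! i) (w !! i) (qs ! Suc i))"

definition run_measure :: "pwa \<Rightarrow> nat stream \<Rightarrow> nat stream measure" where
  "run_measure A w = (THE M. sets M = sets (stream_space (count_space UNIV)) \<and> prob_space M \<and>
     (\<forall>qs. qs \<noteq> [] \<longrightarrow>
        emeasure M {r \<in> space M. stake (length qs) r = qs} = ennreal (prefix_prob A w qs)))"

definition Disc :: "real \<Rightarrow> (nat \<Rightarrow> real) \<Rightarrow> real" where
  "Disc lam v = (\<Sum>i. lam ^ i * v i)"

definition run_weights :: "pwa \<Rightarrow> nat stream \<Rightarrow> nat stream \<Rightarrow> nat \<Rightarrow> real" where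
  "run_weights A w r i = pwa_gamma A (r !! i) (w !! i) (r !! Suc i)"

definition L_pos :: "pwa \<Rightarrow> real \<Rightarrow> nat stream \<Rightarrow> real" where
  "L_pos A lam w = Sup {\<eta>. measure (run_measure A w)
      {r \<in> space (run_measure A w). \<eta> \<le> Disc lam (run_weights A w r)} > 0}"

definition L_as :: "pwa \<Rightarrow> real \<Rightarrow> nat stream \<Rightarrow> real" where
  "L_as A lam w = Sup {\<eta>. measure (run_measure A w)
      {r \<in> space (run_measure A w). \<eta> \<le> Disc lam (run_weights A w r)} = 1}"

definition enc_rat :: "rat \<Rightarrow> nat" where
  "enc_rat r = (case quotient_of r of (a, b) \<Rightarrow> prod_encode (int_encode a, int_encode b))"
definition enc_rl :: "rat list \<Rightarrow> nat" where
  "enc_rl xs = list_encode (map enc_rat xs)"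
definition enc_rlll :: "rat list list list \<Rightarrow> nat" where
  "enc_rlll xsss = list_encode (map (\<lambda>xss. list_encode (map enc_rl xss)) xsss)"

fun enc_instance :: "pwa \<Rightarrow> rat \<Rightarrow> rat \<Rightarrow> nat" where
  "enc_instance (n, k, i, d, g) lam nu =
     list_encode [n, k, enc_rl i, enc_rlll d, enc_rlll g, enc_rat lam, enc_rat nu]"

definition pos_disc_nonempty :: "nat set" where
  "pos_disc_nonempty = {enc_instance A lam nu | A lam nu. pwa_valid A \<and> 0 < lam \<and> lam < 1 \<and>
     (\<exists>w. sset w \<subseteq> {..<pwa_k A} \<and> real_of_rat nu \<le> L_pos A (real_of_rat lam) w)}"

definition as_disc_universal :: "nat set" where
  "as_disc_universal = {enc_instance A lam nu | A lam nu. pwa_valid A \<and> 0 < lam \<and> lam < 1 \<and>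
     (\<forall>w. sset w \<subseteq> {..<pwa_k A} \<longrightarrow> real_of_rat nu \<le> L_as A (real_of_rat lam) w)}"

end

theory Submission
  imports Defs
begin

text \<open>
  A run whose finite prefixes all have positive probability is a path in a finite weighted graph,
  almost every run is of this kind, and the discounted sum is continuous. Hence
  \<open>L_pos A lam w\<close> and \<open>L_as A lam w\<close> are the supremum and the infimum of the discounted sum over
  such paths reading \<open>w\<close>, and quantifying over \<open>w\<close> turns both problems into the optimisation of the
  discounted sum over all paths from an initial state. The optimal values are the solution \<open>v\<close> of
  the Bellman equation, which is rational because an optimal positional policy exists.
  A procedure can therefore search for a rational vector that solves the Bellman equation, which
  is checkable exactly, and compare its entries with the threshold.

  For the counter machines, a small structured loop language is compiled to them, and the unary
  functions it computes are closed under pairing, iteration and unbounded search.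
\<close>

section \<open>A structured language for counter machines\<close>

text \<open>Transition probabilities enter only through their supports: each finite prefix of a
  legal run is a cylinder of positive probability, whereas the run itself may have probability zero.
  An extremal run therefore influences a value only through its neighbourhoods, which forces
  approximation from below in the positive case and a separating threshold in the almost-sure case.
  Since the word is quantified together with the run, the letter and the successor can be chosen
  jointly; no player has to act without knowing the state. Positional choices are then single edges
  of a finite graph. Correctness of the search works for whichever solution is found: the Bellman
  inequalities bound every legal run, and the equalities produce a run that meets the bound. What
  the search does need is a rational solution, for otherwise it would not terminate. A contraction
  argument would only give a real one, so existence goes through a best positional policy.
  Minimisation is maximisation with negated weights. Inputs are arbitrary numbers, so codes of
  well-formed instances must be recognised as well.\<close>

datatype com = Skip | INC nat | Seq com com | Loop nat com

text \<open>The counter is decremented before each round and the body may write to it again.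
  \<open>Loop\<close> is thus a while loop rather than a bounded one, which makes unbounded search
  expressible. The relation only describes terminating executions.\<close>

inductive exec :: "com \<Rightarrow> (nat \<Rightarrow> nat) \<Rightarrow> (nat \<Rightarrow> nat) \<Rightarrow> bool" where
  exec_Skip: "exec Skip s s"
| exec_INC: "exec (INC r) s (s(r := Suc (s r)))"
| exec_Seq: "exec c s s' \<Longrightarrow> exec d s' t \<Longrightarrow> exec (Seq c d) s t"
| exec_Loop_0: "s r = 0 \<Longrightarrow> exec (Loop r c) s s"
| exec_Loop_Suc: "s r = Suc v \<Longrightarrow> exec c (s(r := v)) s' \<Longrightarrow> exec (Loop r c) s' t \<Longrightarrow> exec (Loop r c) s t"

text \<open>There is no unconditional jump; the last two instructions of a loop simulate one.\<close>

fun compile :: "nat \<Rightarrow> com \<Rightarrow> cm_instr list" where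
  "compile p Skip = []"
| "compile p (INC r) = [Inc r (Suc p)]"
| "compile p (Seq c d) = compile p c @ compile (p + length (compile p c)) d"
| "compile p (Loop r c) = Dec r (Suc p) (p + length (compile (Suc p) c) + 3) # compile (Suc p) c @
     [Inc r (p + length (compile (Suc p) c) + 2), Dec r p p]"

definition reaches :: "cm_instr list \<Rightarrow> cm_config \<Rightarrow> cm_config \<Rightarrow> bool" where
  "reaches P x y \<longleftrightarrow> (\<exists>k. (cm_step P ^^ k) x = y)"

lemma reaches_refl: "reaches P x x"
  unfolding reaches_def by (rule exI[of _ 0]) simp

lemma reaches_trans [trans]: "reaches P x y \<Longrightarrow> reaches P y z \<Longrightarrow> reaches P x z"
  unfolding reaches_def by (metis funpow_add comp_apply)

lemma reaches_step: "cm_step P x = y \<Longrightarrow> reaches P x y"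
  unfolding reaches_def by (rule exI[of _ 1]) simp

text \<open>Jump targets are absolute, so code is compiled for the offset at which it is placed. The
  surrounding code \<open>pre\<close> and \<open>post\<close> is arbitrary because the induction
  hypotheses are applied to fragments inside a sequence or a loop body.\<close>

lemma compile_correct:
  assumes "exec c s t" "P = pre @ compile (length pre) c @ post"
  shows "reaches P (length pre, s) (length pre + length (compile (length pre) c), t)"
  using assms
proof (induction arbitrary: pre post rule: exec.induct)
  case (exec_Skip s)
  then show ?case by (simp add: reaches_refl)
next
  case (exec_INC r s)
  then show ?case by (auto intro!: reaches_step simp: cm_step_def nth_append fun_upd_def)
next
  case (exec_Seq c s s' d t)
  have "reaches P (length pre, s) (length pre + length (compile (length pre) c), s')"
    by (rule exec_Seq.IH(1))
      (use exec_Seq.prems in simp)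
  also have "reaches P (length pre + length (compile (length pre) c), s')
     (length pre + length (compile (length pre) (Seq c d)), t)"
    using exec_Seq.prems exec_Seq.IH(2)[of "pre @ compile (length pre) c" post]
    by (simp add: add.assoc)
  finally show ?case .
next
  case (exec_Loop_0 s r c)
  then show ?case by (auto intro!: reaches_step simp: cm_step_def nth_append)
next
  case (exec_Loop_Suc s r v c s' t)
  let ?p = "length pre" and ?B = "compile (Suc (length pre)) c"
  have P: "P = pre @ Dec r (Suc ?p) (?p + length ?B + 3) # ?B @ [Inc r (?p + length ?B + 2), Dec r ?p ?p] @ post"
    using exec_Loop_Suc.prems by simp
  have "reaches P (?p, s) (Suc ?p, s(r := v))"
    using exec_Loop_Suc.hyps by (auto intro!: reaches_step simp: cm_step_def nth_append P)
  also have "reaches P \<dots> (Suc ?p + length ?B, s')"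
    using exec_Loop_Suc.IH(1)[of "pre @ [Dec r (Suc ?p) (?p + length ?B + 3)]"
        "[Inc r (?p + length ?B + 2), Dec r ?p ?p] @ post"] P by (simp add: fun_upd_def)
  also have "reaches P \<dots> (?p + length ?B + 2, s'(r := Suc (s' r)))"
    by (rule reaches_step) (simp add: cm_step_def nth_append P)
  also have "reaches P \<dots> (?p, s')"
    by (rule reaches_step) (auto simp: cm_step_def nth_append P)
  also have "reaches P \<dots> (?p + length (compile ?p (Loop r c)), t)"
    using exec_Loop_Suc.IH(2) exec_Loop_Suc.prems by blast
  finally show ?case .
qed

section \<open>Register contents as lists, and computable functions\<close>

definition stack :: "nat list \<Rightarrow> nat \<Rightarrow> nat" where
  "stack xs r = (if r < length xs then xs ! r else 0)"

text \<open>All registers but the first must be zero at the start and again at the end. This lets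
  programs be chained directly and lets each of them use zero registers as scratch space.\<close>

definition computable :: "(nat \<Rightarrow> nat) \<Rightarrow> bool" where
  "computable f \<longleftrightarrow> (\<exists>c. \<forall>x. exec c (stack [x]) (stack [f x]))"

lemma decidable_computable:
  assumes "computable (\<lambda>x. of_bool (x \<in> S))"
  shows "decidable S"
proof -
  obtain c where c: "\<And>x. exec c (stack [x]) (stack [of_bool (x \<in> S)])"
    using assms by (auto simp: computable_def)
  have "cm_decides (compile 0 c) S"
    unfolding cm_decides_def
  proof
    fix x
    have "stack [x] = (\<lambda>_. 0)(0 := x)"
      by (auto simp: stack_def)
    then obtain k where k: "(cm_step (compile 0 c) ^^ k) (0, (\<lambda>_. 0)(0 := x)) = (length (compile 0 c), stack [of_bool (x \<in> S)])"
      using compile_correct[OF c[of x], of "compile 0 c" "[]" "[]"] by (auto simp: reaches_def)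
    show "\<exists>t. cm_halted (compile 0 c) ((cm_step (compile 0 c) ^^ t) (0, (\<lambda>_. 0)(0 := x))) \<and>
       snd ((cm_step (compile 0 c) ^^ t) (0, (\<lambda>_. 0)(0 := x))) 0 = (if x \<in> S then 1 else 0)"
      by (rule exI[of _ k]) (simp add: k cm_halted_def stack_def)
  qed
  then show ?thesis unfolding decidable_def by blast
qed

fun shift_com :: "nat \<Rightarrow> com \<Rightarrow> com" where
  "shift_com b Skip = Skip"
| "shift_com b (INC r) = INC (b + r)"
| "shift_com b (Seq c d) = Seq (shift_com b c) (shift_com b d)"
| "shift_com b (Loop r c) = Loop (b + r) (shift_com b c)"

lemma exec_cong: "exec c s t \<Longrightarrow> s = s' \<Longrightarrow> t = t' \<Longrightarrow> exec c s' t'"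
  by simp

lemma exec_end: "exec c s t \<Longrightarrow> t = t' \<Longrightarrow> exec c s t'"
  by simp

text \<open>A relocated program leaves the registers below \<open>b\<close> alone. They can hold
  saved data \<open>l\<close> while a subprogram runs.\<close>

lemma exec_shift:
  assumes "exec c s t"
  shows "exec (shift_com b c) (\<lambda>r. if r < b then l r else s (r - b)) (\<lambda>r. if r < b then l r else t (r - b))"
  using assms
proof (induction rule: exec.induct)
  case (exec_INC r s)
  show ?case
    by (simp, rule exec_end[OF exec.exec_INC]) (auto simp: fun_eq_iff)
next
  case (exec_Loop_0 s r c)
  then show ?case by (auto intro: exec.exec_Loop_0)
next
  case (exec_Loop_Suc s r v c s' t)
  show ?case unfolding shift_com.simps
  proof (rule exec.exec_Loop_Suc[OF _ _ exec_Loop_Suc.IH(2)[unfolded shift_com.simps]])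
    show "exec (shift_com b c) ((\<lambda>r. if r < b then l r else s (r - b))(b + r := v)) (\<lambda>r. if r < b then l r else s' (r - b))"
      by (rule exec_cong[OF exec_Loop_Suc.IH(1)]) (auto simp: fun_eq_iff)
  qed (use exec_Loop_Suc.hyps in auto)
qed (auto intro: exec.intros)

lemma exec_stack:
  assumes "exec c (stack xs) (stack xs')" "b = length ys"
  shows "exec (shift_com b c) (stack (ys @ xs)) (stack (ys @ xs'))"
proof -
  have "stack (ys @ zs) = (\<lambda>r. if r < b then stack ys r else stack zs (r - b))" for zs
    by (auto simp: stack_def nth_append assms(2) fun_eq_iff)
  then show ?thesis
    using exec_shift[OF assms(1), of b "stack ys"] by simp
qed

lemma stack_update: "i < length xs \<Longrightarrow> (stack xs)(i := v) = stack (xs[i := v])"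
  by (auto simp: stack_def fun_eq_iff)

lemma stack_pad: "stack (xs @ replicate n 0) = stack xs"
  by (auto simp: stack_def nth_append fun_eq_iff)

lemma exec_INC_st: "r < length xs \<Longrightarrow> exec (INC r) (stack xs) (stack (xs[r := Suc (xs ! r)]))"
  by (rule exec_end[OF exec_INC]) (auto simp: stack_update[symmetric], simp add: stack_def)

lemma exec_Loop_st_0: "r < length xs \<Longrightarrow> xs ! r = 0 \<Longrightarrow> exec (Loop r c) (stack xs) (stack xs)"
  by (rule exec_Loop_0) (simp add: stack_def)

lemma exec_Loop_st_Suc:
  "\<lbrakk>r < length xs; xs ! r = Suc v; exec c (stack (xs[r := v])) s'; exec (Loop r c) s' t\<rbrakk>
    \<Longrightarrow> exec (Loop r c) (stack xs) t"
  by (rule exec_Loop_Suc[of _ _ v]) (auto simp: stack_update, simp add: stack_def)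

lemma exec_clear:
  assumes "i < length xs"
  shows "exec (Loop i Skip) (stack xs) (stack (xs[i := 0]))"
  using assms
proof (induction "xs ! i" arbitrary: xs)
  case 0
  then show ?case by (metis exec_Loop_st_0 list_update_id)
next
  case (Suc v)
  show ?case
    by (rule exec_Loop_st_Suc[of _ _ v, OF _ _ exec_Skip])
      (use Suc(1)[of "xs[i := v]"] Suc(2,3) in auto)
qed

lemma exec_move:
  assumes "i < length xs" "j < length xs" "i \<noteq> j"
  shows "exec (Loop i (INC j)) (stack xs) (stack (xs[i := 0, j := xs ! j + xs ! i]))"
  using assms
proof (induction "xs ! i" arbitrary: xs)
  case 0
  then show ?case by (metis add.right_neutral exec_Loop_st_0 list_update_id)
next
  case (Suc v)
  let ?xs = "xs[i := v, j := Suc (xs ! j)]"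
  have "exec (Loop i (INC j)) (stack xs) (stack (?xs[i := 0, j := ?xs ! j + ?xs ! i]))"
    by (rule exec_Loop_st_Suc[of _ _ v, OF _ _ exec_INC_st[THEN exec_end] Suc(1)])
      (use Suc in auto)
  moreover have "?xs[i := 0, j := ?xs ! j + ?xs ! i] = xs[i := 0, j := xs ! j + xs ! i]"
    using Suc.prems Suc(2)[symmetric] by (intro nth_equalityI) (simp_all add: nth_list_update)
  ultimately show ?case by simp
qed

lemma exec_move2:
  assumes "i < length xs" "j < length xs" "k < length xs" "distinct [i, j, k]"
  shows "exec (Loop i (Seq (INC j) (INC k))) (stack xs)
    (stack (xs[i := 0, j := xs ! j + xs ! i, k := xs ! k + xs ! i]))"
  using assms
proof (induction "xs ! i" arbitrary: xs)
  case 0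
  then show ?case by (metis add.right_neutral exec_Loop_st_0 list_update_id)
next
  case (Suc v)
  let ?xs = "xs[i := v, j := Suc (xs ! j), k := Suc (xs ! k)]"
  have step: "exec (Seq (INC j) (INC k)) (stack (xs[i := v])) (stack ?xs)"
    by (rule exec_Seq[OF exec_INC_st exec_INC_st[THEN exec_end]])
      (use Suc in auto)
  have "exec (Loop i (Seq (INC j) (INC k))) (stack xs)
      (stack (?xs[i := 0, j := ?xs ! j + ?xs ! i, k := ?xs ! k + ?xs ! i]))"
    by (rule exec_Loop_st_Suc[of _ _ v, OF _ _ _ Suc(1)])
      (use step Suc in auto)
  moreover have "?xs[i := 0, j := ?xs ! j + ?xs ! i, k := ?xs ! k + ?xs ! i] =
      xs[i := 0, j := xs ! j + xs ! i, k := xs ! k + xs ! i]"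
    using Suc.prems Suc(2)[symmetric] by (intro nth_equalityI) (simp_all add: nth_list_update)
  ultimately show ?case by simp
qed

lemma computable_id: "computable (\<lambda>x. x)"
  unfolding computable_def using exec_Skip by blast

lemma computable_o:
  assumes "computable f" "computable g" shows "computable (\<lambda>x. f (g x))"
  using assms unfolding computable_def by (meson exec_Seq)

lemma computable_Suc0: "computable Suc"
  unfolding computable_def by (intro exI allI, rule exec_end[OF exec_INC_st[of 0]]) auto

lemma computable_0: "computable (\<lambda>_. 0)"
  unfolding computable_def by (intro exI allI, rule exec_end[OF exec_clear[of 0]]) auto

section \<open>Programs for pairing and unpairing\<close>

definition dup_com :: com where
  "dup_com = Seq (Loop 0 (Seq (INC 1) (INC 2))) (Loop 2 (INC 0))"

lemma exec_dup: "exec dup_com (stack [x]) (stack [x, x])"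
proof -
  have "exec dup_com (stack [x, 0, 0]) (stack [x, x, 0])"
    unfolding dup_com_def
    by (rule exec_Seq[OF exec_move2 exec_move[THEN exec_end]])  auto
  then show ?thesis
    using stack_pad[of "[x]" 2] stack_pad[of "[x, x]" 1] by (simp add: numeral_2_eq_2)
qed

definition swap_com :: com where
  "swap_com = Seq (Loop 0 (INC 2)) (Seq (Loop 1 (INC 0)) (Loop 2 (INC 1)))"

lemma exec_swap: "exec swap_com (stack [x, y]) (stack [y, x])"
proof -
  have "exec swap_com (stack [x, y, 0]) (stack [y, x, 0])"
    unfolding swap_com_def
    by (rule exec_Seq[OF exec_move exec_Seq[OF exec_move exec_move[THEN exec_end]]]) auto
  then show ?thesis
    using stack_pad[of "[x, y]" 1] stack_pad[of "[y, x]" 1] by simp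
qed

text \<open>A round that starts with \<open>Suc s\<close> in register 0 adds \<open>Suc s\<close> to
  register 2: \<open>INC 2\<close> pays for the decrement, the inner loop adds the remaining
  \<open>s\<close>. Register 1 keeps a copy from which register 0 is restored.\<close>

definition triangle_com :: com where
  "triangle_com = Loop 0 (Seq (INC 2) (Seq (Loop 0 (Seq (INC 1) (INC 2))) (Loop 1 (INC 0))))"

lemma exec_triangle: "exec triangle_com (stack [s, 0, t]) (stack [0, 0, triangle s + t])"
proof (induction s arbitrary: t)
  case 0
  show ?case unfolding triangle_com_def by (simp add: exec_Loop_st_0)
next
  case (Suc s)
  have step: "exec (Seq (INC 2) (Seq (Loop 0 (Seq (INC 1) (INC 2))) (Loop 1 (INC 0)))) (stack [s, 0, t]) (stack [s, 0, Suc t + s])"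
    by (rule exec_Seq[OF exec_INC_st exec_Seq[OF exec_move2 exec_move[THEN exec_end]]]) auto
  show ?case
    unfolding triangle_com_def
    by (rule exec_Loop_st_Suc[of _ _ s])
      (use step Suc[of "Suc t + s", unfolded triangle_com_def] in \<open>auto simp: algebra_simps\<close>)
qed

text \<open>The code of \<open>(a, b)\<close> is \<open>triangle (a + b) + a\<close>. With
  \<open>b\<close> in register 0 and \<open>a\<close> in register 1, a single loop over
  \<open>a\<close> produces both the sum and the addend, the latter in register 2 where
  \<open>triangle_com\<close> accumulates.\<close>

definition pair_com :: com where
  "pair_com = Seq (Loop 1 (Seq (INC 0) (INC 2))) (Seq triangle_com (Loop 2 (INC 0)))"

lemma exec_pair: "exec pair_com (stack [b, a]) (stack [prod_encode (a, b)])"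
proof -
  have "exec pair_com (stack [b, a, 0]) (stack [prod_encode (a, b), 0, 0])"
    unfolding pair_com_def
    by (rule exec_Seq[OF exec_move2[THEN exec_end] exec_Seq[OF exec_triangle exec_move[THEN exec_end]]])
      (auto simp: prod_encode_def add.commute)
  then show ?thesis
    using stack_pad[of "[b, a]" 1] stack_pad[of "[prod_encode (a, b)]" 2] by (simp add: numeral_2_eq_2)
qed

text \<open>The argument has to survive the first call, so \<open>g\<close> is evaluated on a copy
  one register up. After the swap \<open>f\<close> consumes the original, which leaves the two
  results in the order that \<open>pair_com\<close> expects.\<close>

lemma computable_Pair:
  assumes "computable f" "computable g"
  shows "computable (\<lambda>x. prod_encode (f x, g x))"
proof -
  obtain c d where c: "\<And>x. exec c (stack [x]) (stack [f x])" and d: "\<And>x. exec d (stack [x]) (stack [g x])"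
    using assms by (auto simp: computable_def)
  have "exec (Seq dup_com (Seq (shift_com 1 d) (Seq swap_com (Seq (shift_com 1 c) pair_com)))) (stack [x])
     (stack [prod_encode (f x, g x)])" for x
    by (rule exec_Seq[OF exec_dup exec_Seq[OF _ exec_Seq[OF exec_swap exec_Seq[OF _ exec_pair]]]])
      (use exec_stack[OF c, of 1 "[g x]" x] exec_stack[OF d, of 1 "[x]" x] in auto)
  then show ?thesis unfolding computable_def by blast
qed

text \<open>The loop body maps the pair with code \<open>z\<close> to the pair with code \<open>z + 1\<close>:
  \<open>(a, b + 1)\<close> to \<open>(a + 1, b)\<close> and \<open>(a, 0)\<close> to \<open>(0, a + 1)\<close>.\<close>

definition unpair_body :: com where
  "unpair_body = Seq (INC 3) (Seq (Loop 2 (Seq (INC 4) (Loop 3 Skip)))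
    (Seq (Loop 3 (Seq (Loop 1 (INC 2)) (INC 2))) (Loop 4 (Seq (INC 1) (Loop 4 (INC 2))))))"

definition next_pair :: "nat \<times> nat \<Rightarrow> nat \<times> nat" where
  "next_pair p = (case p of (a, 0) \<Rightarrow> (0, Suc a) | (a, Suc b) \<Rightarrow> (Suc a, b))"

lemma prod_encode_next_pair: "prod_encode (next_pair p) = Suc (prod_encode p)"
  by (cases p) (auto simp: next_pair_def prod_encode_def split: nat.splits)

text \<open>This is a zero test: the flag \<open>e\<close> in register 3 survives exactly if
  register 2 held zero, and register 4 saves the tested value.\<close>

lemma exec_test: "exec (Loop 2 (Seq (INC 4) (Loop 3 Skip))) (stack [z, a, b, e, d])
    (stack [z, a, 0, if b = 0 then e else 0, b + d])"
proof (induction b arbitrary: e d)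
  case 0
  show ?case by (simp add: exec_Loop_st_0)
next
  case (Suc b)
  have step: "exec (Seq (INC 4) (Loop 3 Skip)) (stack [z, a, b, e, d]) (stack [z, a, b, 0, Suc d])"
    by (rule exec_Seq[OF exec_INC_st exec_clear[THEN exec_end]]) auto
  show ?case
    by (rule exec_Loop_st_Suc[of _ _ b])
      (use step Suc[of 0 "Suc d"] in auto)
qed

text \<open>The last two loops act as conditionals. \<open>Loop 3\<close> is entered with a flag of
  at most one, and the body of \<open>Loop 4\<close> drains its own counter, so each runs at most
  once. The decrement on entering \<open>Loop 4\<close> already turns \<open>Suc b'\<close> into
  \<open>b'\<close>.\<close>

lemma exec_unpair_body:
  "exec unpair_body (stack [z, a, b, 0, 0]) (stack [z, fst (next_pair (a, b)), snd (next_pair (a, b)), 0, 0])"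
proof (cases b)
  case 0
  have step: "exec (Loop 3 (Seq (Loop 1 (INC 2)) (INC 2))) (stack [z, a, 0, 1, 0]) (stack [z, 0, Suc a, 0, 0])"
    by (rule exec_Loop_st_Suc[of _ _ 0, OF _ _ exec_Seq[OF exec_move exec_INC_st] exec_Loop_st_0[THEN exec_end]]) auto
  show ?thesis
    unfolding unpair_body_def
    by (rule exec_Seq[OF exec_INC_st exec_Seq[OF _ exec_Seq[OF _ exec_Loop_st_0[THEN exec_end]]]])
      (use step exec_test[of z a b 1 0] 0 in \<open>auto simp: next_pair_def\<close>)
next
  case (Suc b')
  have step: "exec (Loop 4 (Seq (INC 1) (Loop 4 (INC 2)))) (stack [z, a, 0, 0, b]) (stack [z, Suc a, b', 0, 0])"
    by (rule exec_Loop_st_Suc[of _ _ b', OF _ _ exec_Seq[OF exec_INC_st exec_move] exec_Loop_st_0[THEN exec_end]])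
       (auto simp: Suc)
  show ?thesis
    unfolding unpair_body_def
    by (rule exec_Seq[OF exec_INC_st exec_Seq[OF _ exec_Seq[OF exec_Loop_st_0]]])
      (use step exec_test[of z a b 1 0] Suc in \<open>auto simp: next_pair_def\<close>)
qed

text \<open>Decoding walks \<open>z\<close> steps along the Cantor enumeration from
  \<open>(0, 0)\<close>, the pair with code 0. The induction needs an arbitrary starting pair
  \<open>p\<close>.\<close>

lemma exec_unpair: "exec (Loop 0 unpair_body) (stack [z]) (stack [0, fst (prod_decode z), snd (prod_decode z)])"
proof -
  have "exec (Loop 0 unpair_body) (stack [z, fst p, snd p, 0, 0])
     (stack [0, fst (prod_decode (prod_encode p + z)), snd (prod_decode (prod_encode p + z)), 0, 0])" for p
  proof (induction z arbitrary: p)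
    case 0
    show ?case by (simp add: exec_Loop_st_0)
  next
    case (Suc z)
    show ?case
      by (rule exec_Loop_st_Suc[of _ _ z])
      (use exec_unpair_body[of z "fst p" "snd p"] Suc[of "next_pair p"] in \<open>auto simp: prod_encode_next_pair\<close>)
  qed
  from this[of "(0, 0)"] show ?thesis
    using stack_pad[of "[z]" 4] stack_pad[of "[0, fst (prod_decode z), snd (prod_decode z)]" 2]
    by (simp add: prod_encode_def eval_nat_numeral)
qed

definition code_fst :: "nat \<Rightarrow> nat" where "code_fst z = fst (prod_decode z)"
definition code_snd :: "nat \<Rightarrow> nat" where "code_snd z = snd (prod_decode z)"

lemma code_fst_pair [simp]: "code_fst (prod_encode (a, b)) = a"
  and code_snd_pair [simp]: "code_snd (prod_encode (a, b)) = b"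
  by (simp_all add: code_fst_def code_snd_def)

lemma pair_code_fst_snd [simp]: "prod_encode (code_fst z, code_snd z) = z"
  by (simp add: code_fst_def code_snd_def)

lemma computable_code_fst_base: "computable code_fst"
proof -
  have "exec (Seq (Loop 0 unpair_body) (Seq (Loop 1 (INC 0)) (Loop 2 Skip))) (stack [z]) (stack [code_fst z, 0, 0])" for z
    by (rule exec_Seq[OF exec_unpair exec_Seq[OF exec_move exec_clear[THEN exec_end]]]) (auto simp: code_fst_def)
  then show ?thesis
    unfolding computable_def using stack_pad[of "[code_fst _]" 2] by (auto simp: eval_nat_numeral)
qed

lemma computable_code_snd_base: "computable code_snd"
proof -
  have "exec (Seq (Loop 0 unpair_body) (Seq (Loop 2 (INC 0)) (Loop 1 Skip))) (stack [z]) (stack [code_snd z, 0, 0])" for z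
    by (rule exec_Seq[OF exec_unpair exec_Seq[OF exec_move exec_clear[THEN exec_end]]]) (auto simp: code_snd_def)
  then show ?thesis
    unfolding computable_def using stack_pad[of "[code_snd _]" 2] by (auto simp: eval_nat_numeral)
qed

section \<open>Iteration and unbounded search\<close>

lemma computable_iter_base:
  assumes "computable h"
  shows "computable (\<lambda>z. (h ^^ code_fst z) (code_snd z))"
proof -
  obtain c where c: "\<And>x. exec c (stack [x]) (stack [h x])"
    using assms by (auto simp: computable_def)
  have loop: "exec (Loop 0 (shift_com 1 c)) (stack [n, y]) (stack [0, (h ^^ n) y])" for n y
  proof (induction n arbitrary: y)
    case 0
    show ?case by (simp add: exec_Loop_st_0)
  next
    case (Suc n)
    show ?case
      by (rule exec_Loop_st_Suc[of _ _ n])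
      (use exec_stack[OF c, of 1 "[n]" y] Suc[of "h y"] in \<open>auto simp: funpow_swap1\<close>)
  qed
  have unpack: "exec (Seq (Loop 0 unpair_body) (Seq (Loop 1 (INC 0)) (Loop 2 (INC 1)))) (stack [z]) (stack [code_fst z, code_snd z, 0])" for z
    by (rule exec_Seq[OF exec_unpair exec_Seq[OF exec_move exec_move[THEN exec_end]]]) (auto simp: code_fst_def code_snd_def)
  have "exec (Seq (Seq (Loop 0 unpair_body) (Seq (Loop 1 (INC 0)) (Loop 2 (INC 1)))) (Seq (Loop 0 (shift_com 1 c)) (Loop 1 (INC 0))))
     (stack [z]) (stack [(h ^^ code_fst z) (code_snd z), 0])" for z
    by (rule exec_Seq[OF unpack exec_Seq[OF _ exec_move[THEN exec_end]]])
      (use loop stack_pad[of "[code_fst z, code_snd z]" 1] in auto)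
  then show ?thesis
    unfolding computable_def using stack_pad[of "[(h ^^ code_fst _) (code_snd _)]" 1] by (auto simp: eval_nat_numeral)
qed

text \<open>Register 1 holds the current value of the test \<open>t\<close>; each round discards it,
  applies \<open>h\<close> and tests anew. The induction is on the number of rounds left, and a zero
  test leaves register 1 clean on exit.\<close>

lemma computable_while_base:
  assumes "computable t" "computable h" and ex: "\<And>x. \<exists>m. t ((h ^^ m) x) = 0"
  shows "computable (\<lambda>x. (h ^^ (LEAST m. t ((h ^^ m) x) = 0)) x)"
proof -
  obtain c where c: "\<And>x. exec c (stack [x]) (stack [h x])"
    using assms by (auto simp: computable_def)
  obtain d where d: "\<And>x. exec d (stack [x]) (stack [t x])"
    using assms by (auto simp: computable_def)
  define test where "test = Seq dup_com (shift_com 1 d)"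
  have test: "exec test (stack [x]) (stack [x, t x])" for x
    unfolding test_def
    by (rule exec_Seq[OF exec_dup])
      (use exec_stack[OF d, of 1 "[x]" x] in simp)
  define body where "body = Seq (Loop 1 Skip) (Seq c test)"
  have body: "exec body (stack [x, v]) (stack [h x, t (h x)])" for x v
    unfolding body_def
    by (rule exec_Seq[OF exec_clear[THEN exec_end] exec_Seq[OF c test]])
      (use stack_pad[of "[x]" 1] in auto)
  have "exec (Loop 1 body) (stack [x, t x]) (stack [(h ^^ (LEAST m. t ((h ^^ m) x) = 0)) x])" for x
  proof (induction "LEAST m. t ((h ^^ m) x) = 0" arbitrary: x)
    case 0
    then have "t x = 0" using LeastI_ex[OF ex[of x]] by simp
    then show ?case using 0 stack_pad[of "[x]" 1] exec_Loop_st_0[of 1 "[x, 0]" body] by simp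
  next
    case (Suc m)
    have tx: "t x \<noteq> 0"
      using not_less_Least[of 0 "\<lambda>m. t ((h ^^ m) x) = 0"] Suc.hyps(2) by simp
    have "(LEAST m. t ((h ^^ m) x) = 0) = Suc (LEAST m. t ((h ^^ m) (h x)) = 0)"
      using Least_Suc[of "\<lambda>m. t ((h ^^ m) x) = 0"] LeastI_ex[OF ex[of x]] tx by (simp add: funpow_swap1)
    then have m: "m = (LEAST m. t ((h ^^ m) (h x)) = 0)" using Suc.hyps(2) by simp
    have step: "exec (Loop 1 body) (stack [h x, t (h x)]) (stack [(h ^^ m) (h x)])"
      using Suc.hyps(1)[OF m] m by simp
    show ?case
      by (rule exec_Loop_st_Suc[of _ _ "t x - 1"])
       (use step tx body[of x "t x - 1"] in \<open>auto simp: funpow_swap1 Suc.hyps(2)[symmetric]\<close>)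
  qed
  with test have "exec (Seq test (Loop 1 body)) (stack [x]) (stack [(h ^^ (LEAST m. t ((h ^^ m) x) = 0)) x])" for x
    by (blast intro: exec_Seq)
  then show ?thesis unfolding computable_def by blast
qed

section \<open>Computable functions on numbers, integers, rationals and lists\<close>

lemma computable_const: "computable (\<lambda>_. n)"
  by (induction n) (auto intro: computable_0 computable_o[OF computable_Suc0])

lemma computable_Suc: "computable f \<Longrightarrow> computable (\<lambda>x. Suc (f x))"
  by (rule computable_o[OF computable_Suc0])

lemma computable_code_fst: "computable f \<Longrightarrow> computable (\<lambda>x. code_fst (f x))"
  by (rule computable_o[OF computable_code_fst_base])

lemma computable_code_snd: "computable f \<Longrightarrow> computable (\<lambda>x. code_snd (f x))"
  by (rule computable_o[OF computable_code_snd_base])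

text \<open>The basic iteration rule has one fixed step function, so the parameter \<open>x\<close>
  travels unchanged in the first component of the iterated pair.\<close>

lemma computable_funpow:
  assumes "computable n" "computable a" "computable (\<lambda>z. h (code_fst z) (code_snd z))"
  shows "computable (\<lambda>x. (h x ^^ n x) (a x))"
proof -
  let ?h = "\<lambda>z. prod_encode (code_fst z, h (code_fst z) (code_snd z))"
  have "(?h ^^ m) (prod_encode (x, y)) = prod_encode (x, (h x ^^ m) y)" for m x y
    by (induction m) auto
  moreover have "computable ?h"
    by (intro computable_Pair computable_code_fst computable_id assms)
  from computable_code_snd[OF computable_o[OF computable_iter_base[OF this]]]
  have "computable (\<lambda>x. code_snd ((?h ^^ code_fst (prod_encode (n x, prod_encode (x, a x)))) (code_snd (prod_encode (n x, prod_encode (x, a x))))))"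
    by this (intro computable_Pair computable_id assms)
  ultimately show ?thesis
    by simp
qed

lemma computable_rec_nat:
  assumes "computable n" "computable a" "computable (\<lambda>z. g (code_fst z) (code_fst (code_snd z)) (code_snd (code_snd z)))"
  shows "computable (\<lambda>x. rec_nat (a x) (g x) (n x))"
proof -
  let ?h = "\<lambda>x s. prod_encode (Suc (code_fst s), g x (code_fst s) (code_snd s))"
  have "(?h x ^^ m) (prod_encode (0, y)) = prod_encode (m, rec_nat y (g x) m)" for m x y
    by (induction m) auto
  moreover have "computable (\<lambda>x. (?h x ^^ n x) (prod_encode (0, a x)))"
    by (intro computable_funpow computable_Pair computable_Suc computable_code_fst computable_code_snd computable_id computable_0 assms)
  then have "computable (\<lambda>x. code_snd ((?h x ^^ n x) (prod_encode (0, a x))))"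
    by (rule computable_code_snd)
  ultimately show ?thesis
    by simp
qed

lemma computable_add:
  assumes "computable f" "computable g" shows "computable (\<lambda>x. f x + g x)"
proof -
  have "n + m = rec_nat n (\<lambda>_. Suc) m" for n m :: nat
    by (induction m) auto
  then show ?thesis
    using computable_rec_nat[OF assms(2,1), of "\<lambda>_ _. Suc"]
    by (simp add: computable_Suc computable_code_snd computable_id)
qed

lemma computable_mult:
  assumes "computable f" "computable g" shows "computable (\<lambda>x. f x * g x)"
proof -
  have "f x * m = rec_nat 0 (\<lambda>_ y. f x + y) m" for x m
    by (induction m) auto
  then show ?thesis
    using computable_rec_nat[OF assms(2) computable_0, of "\<lambda>x _ y. f x + y"]
    by (simp add: computable_add computable_code_fst computable_code_snd computable_id computable_o[OF assms(1)])
qed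

lemma computable_pred: "computable f \<Longrightarrow> computable (\<lambda>x. f x - 1)"
proof -
  assume f: "computable f"
  have "m - 1 = rec_nat 0 (\<lambda>i _. i) m" for m
    by (cases m) auto
  then show ?thesis
    using computable_rec_nat[OF f computable_0, of "\<lambda>_ i _. i"]
    by (simp add: computable_code_fst computable_code_snd computable_id)
qed

lemma computable_diff:
  assumes "computable f" "computable g" shows "computable (\<lambda>x. f x - g x)"
proof -
  have "rec_nat n (\<lambda>_ y. y - 1) m = n - m" for n m :: nat
    by (induction m) auto
  then show ?thesis
    using computable_rec_nat[OF assms(2,1), of "\<lambda>_ _ y. y - 1"]
      computable_pred[OF computable_code_snd[OF computable_code_snd[OF computable_id]]] by simp
qed

definition computable_bool :: "(nat \<Rightarrow> bool) \<Rightarrow> bool" where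
  "computable_bool P \<longleftrightarrow> computable (\<lambda>x. of_bool (P x))"

lemma computable_bool_o: "computable_bool P \<Longrightarrow> computable f \<Longrightarrow> computable_bool (\<lambda>x. P (f x))"
  unfolding computable_bool_def by (rule computable_o)

lemma computable_bool_const: "computable_bool (\<lambda>_. b)"
  unfolding computable_bool_def by (rule computable_const)

lemma computable_bool_le:
  assumes "computable f" "computable g" shows "computable_bool (\<lambda>x. f x \<le> g x)"
proof -
  have "of_bool (f x \<le> g x) = 1 - (f x - g x)" for x
    by auto
  then show ?thesis
    unfolding computable_bool_def by (simp only: computable_diff computable_const assms)
qed

lemma computable_bool_not: "computable_bool P \<Longrightarrow> computable_bool (\<lambda>x. \<not> P x)"
proof -
  assume P: "computable_bool P"
  have "of_bool (\<not> P x) = 1 - (of_bool (P x) :: nat)" for x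
    by auto
  with P show ?thesis
    unfolding computable_bool_def by (simp only: computable_diff computable_const)
qed

lemma computable_bool_conj:
  assumes "computable_bool P" "computable_bool Q" shows "computable_bool (\<lambda>x. P x \<and> Q x)"
proof -
  have "of_bool (P x \<and> Q x) = (of_bool (P x) * of_bool (Q x) :: nat)" for x
    by auto
  with assms show ?thesis
    unfolding computable_bool_def by (simp only: computable_mult)
qed

lemma computable_bool_disj:
  "computable_bool P \<Longrightarrow> computable_bool Q \<Longrightarrow> computable_bool (\<lambda>x. P x \<or> Q x)"
  using computable_bool_not[OF computable_bool_conj[OF computable_bool_not computable_bool_not]] by auto

lemma computable_bool_imp:
  "computable_bool P \<Longrightarrow> computable_bool Q \<Longrightarrow> computable_bool (\<lambda>x. P x \<longrightarrow> Q x)"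
  unfolding imp_conv_disj by (intro computable_bool_disj computable_bool_not)

lemma computable_bool_less:
  "computable f \<Longrightarrow> computable g \<Longrightarrow> computable_bool (\<lambda>x. f x < g x)"
  unfolding not_le[symmetric] by (intro computable_bool_not computable_bool_le)

lemma computable_bool_eq:
  "computable f \<Longrightarrow> computable g \<Longrightarrow> computable_bool (\<lambda>x. f x = g x)"
  unfolding order.eq_iff by (intro computable_bool_conj computable_bool_le)

lemma computable_if:
  assumes "computable_bool P" "computable f" "computable g"
  shows "computable (\<lambda>x. if P x then f x else g x)"
proof -
  have "(if P x then f x else g x) = of_bool (P x) * f x + of_bool (\<not> P x) * g x" for x
    by auto
  then show ?thesis
    using assms(1) computable_bool_not[OF assms(1)] assms(2,3) unfolding computable_bool_def
    by (simp only: computable_add computable_mult)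
qed

lemma computable_bool_all_less:
  assumes "computable n" "computable_bool (\<lambda>z. P (code_fst z) (code_snd z))"
  shows "computable_bool (\<lambda>x. \<forall>i<n x. P x i)"
proof -
  have "rec_nat 1 (\<lambda>i y. y * of_bool (P x i)) m = (of_bool (\<forall>i<m. P x i) :: nat)" for x m
    by (induction m) (auto simp: less_Suc_eq)
  moreover have "computable (\<lambda>x. rec_nat 1 (\<lambda>i y. y * of_bool (P x i)) (n x))"
    using computable_o[OF assms(2)[unfolded computable_bool_def], of "\<lambda>z. prod_encode (code_fst z, code_fst (code_snd z))"]
    by (intro computable_rec_nat assms(1) computable_const computable_mult computable_code_fst computable_code_snd computable_id)
      (simp_all add: computable_Pair computable_code_fst computable_code_snd computable_id)
  ultimately show ?thesis
    unfolding computable_bool_def by simp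
qed

lemma computable_bool_ex_less:
  assumes "computable n" "computable_bool (\<lambda>z. P (code_fst z) (code_snd z))"
  shows "computable_bool (\<lambda>x. \<exists>i<n x. P x i)"
  using computable_bool_not[OF computable_bool_all_less[OF assms(1), of "\<lambda>x i. \<not> P x i"]] assms(2)
  by (simp add: computable_bool_not)

lemma computable_Least:
  assumes "computable_bool (\<lambda>z. P (code_fst z) (code_snd z))" "\<And>x. \<exists>y. P x y"
  shows "computable (\<lambda>x. LEAST y. P x y)"
proof -
  let ?h = "\<lambda>z. prod_encode (code_fst z, Suc (code_snd z))"
  have h: "(?h ^^ m) z = prod_encode (code_fst z, code_snd z + m)" for m z
    by (induction m) auto
  \<comment> \<open>A loop test that looks back at all earlier candidates is needed because the
    while rule requires termination from every starting pair.\<close>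
  let ?t = "\<lambda>z. of_bool (\<forall>y<Suc (code_snd z). \<not> P (code_fst z) y) :: nat"
  have "computable (\<lambda>z. (?h ^^ (LEAST m. ?t ((?h ^^ m) z) = 0)) z)"
  proof (rule computable_while_base)
    show "computable ?t"
      using computable_bool_all_less[of "\<lambda>z. Suc (code_snd z)" "\<lambda>z y. \<not> P (code_fst z) y"]
        computable_bool_o[OF computable_bool_not[OF assms(1)], of "\<lambda>z. prod_encode (code_fst (code_fst z), code_snd z)"]
      by (simp add: computable_bool_def[symmetric] computable_Suc computable_Pair computable_code_fst computable_code_snd computable_id)
    show "computable ?h"
      by (intro computable_Pair computable_Suc computable_code_fst computable_code_snd computable_id)
    show "\<exists>m. ?t ((?h ^^ m) z) = 0" for z
    proof -
      obtain y where "P (code_fst z) y" using assms(2) by blast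
      then have "\<exists>y'<Suc (code_snd z + y). P (code_fst z) y'" by (intro exI[of _ y]) auto
      then show ?thesis by (intro exI[of _ y]) (simp add: h)
    qed
  qed
  from computable_code_snd[OF computable_o[OF this]]
  have "computable (\<lambda>x. code_snd ((?h ^^ (LEAST m. ?t ((?h ^^ m) (prod_encode (x, 0))) = 0)) (prod_encode (x, 0))))"
    by this (intro computable_Pair computable_id computable_0)
  moreover have "(LEAST m. \<exists>y<Suc m. P x y) = (LEAST y. P x y)" for x
    by (rule Least_equality) (use LeastI_ex[OF assms(2)[of x]] Least_le[of "P x"] in \<open>force+\<close>)
  ultimately show ?thesis
    by (simp add: h)
qed

text \<open>Since search is unbounded, a function is computable as soon as its graph is decidable.\<close>

lemma computable_graph:
  assumes "computable_bool (\<lambda>z. f (code_fst z) = code_snd z)"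
  shows "computable f"
  using computable_Least[OF assms] by (simp add: Least_equality)

lemmas computable_nat_intros =
  computable_id computable_const computable_Suc computable_code_fst computable_code_snd computable_Pair
  computable_add computable_mult computable_diff computable_if

lemmas computable_bool_intros =
  computable_bool_const computable_bool_le computable_bool_not computable_bool_conj
  computable_bool_disj computable_bool_imp computable_bool_less computable_bool_eq
  computable_bool_all_less computable_bool_ex_less

lemma computable_bool_dvd:
  assumes "computable f" "computable g" shows "computable_bool (\<lambda>x. f x dvd g x)"
proof -
  have "a dvd b \<longleftrightarrow> (\<exists>k<Suc b. b = a * k)" for a b :: nat
  proof
    assume "a dvd b"
    then obtain k where k: "b = a * k" ..
    show "\<exists>k<Suc b. b = a * k"
    proof (cases "a = 0")
      case True then show ?thesis using k by auto
    next
      case False then show ?thesis using k by (intro exI[of _ k]) (auto simp: less_Suc_eq_le)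
    qed
  qed auto
  then show ?thesis
    by (simp only:, intro computable_bool_intros computable_nat_intros computable_o[OF assms(1)] computable_o[OF assms(2)] assms)
qed

lemma computable_bool_coprime:
  assumes "computable f" "computable g" shows "computable_bool (\<lambda>x. coprime (f x) (g x))"
proof -
  \<comment> \<open>Common divisors of two numbers that are not both zero are at most
    \<open>a + b\<close>, so coprimality is a bounded search.\<close>
  have "coprime a b \<longleftrightarrow> (\<forall>d<Suc (a + b). d dvd a \<and> d dvd b \<longrightarrow> d = 1 \<or> d = 0)
      \<and> \<not> (a = 0 \<and> b = 0)" for a b :: nat
  proof
    assume R: "(\<forall>d<Suc (a + b). d dvd a \<and> d dvd b \<longrightarrow> d = 1 \<or> d = 0) \<and> \<not> (a = 0 \<and> b = 0)"
    then have "gcd a b < Suc (a + b)" "gcd a b \<noteq> 0"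
      by (cases "a = 0"; cases "b = 0"; auto intro!: le_imp_less_Suc simp: gcd_le1_nat trans_le_add1)+
    with R have "gcd a b = 1"
      using R[THEN conjunct1, rule_format, of "gcd a b"] by auto
    then show "coprime a b" by (simp add: coprime_iff_gcd_eq_1)
  qed (auto dest: coprime_common_divisor)
  then show ?thesis
    by (simp only:, intro computable_bool_intros computable_nat_intros computable_bool_dvd computable_o[OF assms(1)] computable_o[OF assms(2)] assms)
qed

section \<open>Integers\<close>

definition computable_int :: "(nat \<Rightarrow> int) \<Rightarrow> bool" where
  "computable_int f \<longleftrightarrow> computable (\<lambda>x. int_encode (f x))"

lemma int_encode_eq: "int_encode i = (if i \<ge> 0 then 2 * nat i else 2 * nat (- i - 1) + 1)"
  by (simp add: int_encode_def sum_encode_def)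

lemma computable_int_decode: "computable f \<Longrightarrow> computable_int (\<lambda>x. int_decode (f x))"
  unfolding computable_int_def by simp

lemma computable_int_diff_nat:
  assumes "computable f" "computable g"
  shows "computable_int (\<lambda>x. int (f x) - int (g x))"
proof -
  have "int_encode (int a - int b) = (if b \<le> a then 2 * (a - b) else 2 * (b - a - 1) + 1)" for a b
    by (auto simp: int_encode_eq nat_diff_distrib)
  then show ?thesis
    unfolding computable_int_def
    by (simp only:, intro computable_bool_intros computable_nat_intros assms)
qed

text \<open>Even codes \<open>2 * y\<close> stand for nonnegative integers and odd ones for negative
  integers. Testing a proposed result by doubling avoids having to halve the code.\<close>

lemma computable_nat:
  assumes "computable_int f" shows "computable (\<lambda>x. nat (f x))"
proof (rule computable_graph)
  have f: "computable (\<lambda>z. int_encode (f (code_fst z)))"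
    by (intro computable_o[OF assms[unfolded computable_int_def]] computable_nat_intros)
  have "nat i = y \<longleftrightarrow> int_encode i = 2 * y \<or> (y = 0 \<and> (\<exists>k<Suc (int_encode i). int_encode i = 2 * k + 1))" for i y
  proof (cases "i \<ge> 0")
    case False
    then have "\<exists>k<Suc (int_encode i). int_encode i = 2 * k + 1"
      by (intro exI[of _ "nat (- i - 1)"]) (auto simp: int_encode_eq)
    with False show ?thesis by (auto simp: int_encode_eq) presburger
  qed (auto simp: int_encode_eq, presburger+)
  then show "computable_bool (\<lambda>z. nat (f (code_fst z)) = code_snd z)"
    by (simp only:, intro computable_bool_intros computable_nat_intros f computable_o[OF f])
qed

text \<open>For positive \<open>m\<close> the codes of \<open>m\<close> and \<open>- m\<close> are
  \<open>2 * m\<close> and \<open>2 * m - 1\<close>, so negation moves a nonzero code by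
  one.\<close>

lemma computable_int_uminus:
  assumes "computable_int f" shows "computable_int (\<lambda>x. - f x)"
proof -
  have "int_encode (- i) = (if int_encode i = 0 then 0 else if nat i = 0 then int_encode i + 1 else int_encode i - 1)" for i
    by (auto simp: int_encode_eq)
  then show ?thesis
    unfolding computable_int_def
    by (simp only:, intro computable_bool_intros computable_nat_intros assms[unfolded computable_int_def] computable_nat[OF assms])
qed

text \<open>Splitting \<open>i\<close> into \<open>nat i\<close> and \<open>nat (- i)\<close>, its
  positive and negative part, reduces integer operations to operations on naturals and one final
  difference.\<close>

lemma computable_int_add:
  assumes "computable_int f" "computable_int g" shows "computable_int (\<lambda>x. f x + g x)"
proof -
  have "i + j = int (nat i + nat j) - int (nat (- i) + nat (- j))" for i j
    by auto
  then show ?thesis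
    by (simp only:, intro computable_int_diff_nat computable_nat_intros computable_nat computable_int_uminus assms)
qed

lemma computable_int_mult:
  assumes "computable_int f" "computable_int g" shows "computable_int (\<lambda>x. f x * g x)"
proof -
  have "i * j = int (nat i * nat j + nat (- i) * nat (- j)) - int (nat i * nat (- j) + nat (- i) * nat j)" for i j
  proof -
    have "i * j = (int (nat i) - int (nat (- i))) * (int (nat j) - int (nat (- j)))"
      by auto
    moreover have "(int a - int b) * (int c - int d) = int (a * c + b * d) - int (a * d + b * c)" for a b c d
      by (simp add: algebra_simps)
    ultimately show ?thesis
      by metis
  qed
  then show ?thesis
    by (simp only:, intro computable_int_diff_nat computable_nat_intros computable_nat computable_int_uminus assms)
qed

lemma computable_bool_int_le:
  assumes "computable_int f" "computable_int g" shows "computable_bool (\<lambda>x. f x \<le> g x)"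
proof -
  have "i \<le> j \<longleftrightarrow> nat i + nat (- j) \<le> nat j + nat (- i)" for i j
    by auto
  then show ?thesis
    by (simp only:, intro computable_bool_intros computable_nat_intros computable_nat computable_int_uminus assms)
qed

lemma computable_bool_int_eq:
  assumes "computable_int f" "computable_int g" shows "computable_bool (\<lambda>x. f x = g x)"
  using computable_bool_conj[OF computable_bool_int_le[OF assms] computable_bool_int_le[OF assms(2,1)]]
  by (simp add: eq_iff)

lemma computable_int_const: "computable_int (\<lambda>_. i)"
  unfolding computable_int_def by (rule computable_const)

section \<open>Rationals\<close>

definition computable_rat :: "(nat \<Rightarrow> rat) \<Rightarrow> bool" where
  "computable_rat f \<longleftrightarrow> computable (\<lambda>x. enc_rat (f x))"

definition dec_rat :: "nat \<Rightarrow> rat" where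
  "dec_rat c = Fract (int_decode (code_fst c)) (int_decode (code_snd c))"

text \<open>Only fractions in lowest terms with positive denominator are values of
  \<open>enc_rat\<close>, while \<open>dec_rat\<close> accepts any pair. The sum
  \<open>nat i + nat (- i)\<close> is the absolute value, in a form already known to be
  computable.\<close>

definition is_rat :: "nat \<Rightarrow> bool" where
  "is_rat c \<longleftrightarrow> 0 < nat (int_decode (code_snd c)) \<and>
     coprime (nat (int_decode (code_fst c)) + nat (- int_decode (code_fst c))) (nat (int_decode (code_snd c)))"

lemma nat_abs_eq: "nat \<bar>i\<bar> = nat i + nat (- i)"
  by auto

lemma is_rat_iff: "is_rat c \<longleftrightarrow> 0 < int_decode (code_snd c) \<and> coprime (int_decode (code_fst c)) (int_decode (code_snd c))"
proof -
  have "coprime a b \<longleftrightarrow> coprime (nat \<bar>a\<bar>) (nat b)" if "b > 0" for a b :: int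
    using that by (metis abs_of_pos coprime_nat_abs_left_iff coprime_nat_abs_right_iff coprime_int_iff nat_0_le abs_ge_zero coprime_abs_left_iff less_imp_le)
  then show ?thesis
    unfolding is_rat_def nat_abs_eq[symmetric] by auto
qed

lemma dec_enc_rat [simp]: "dec_rat (enc_rat r) = r"
  by (cases "quotient_of r") (simp add: enc_rat_def dec_rat_def quotient_of_def, metis quotient_of_div Fract_of_int_quotient quotient_of_def)

lemma enc_dec_rat: "is_rat c \<Longrightarrow> enc_rat (dec_rat c) = c"
  by (simp add: is_rat_iff enc_rat_def dec_rat_def quotient_of_Fract normalize_stable coprime_commute)

lemma is_rat_enc_rat [simp]: "is_rat (enc_rat r)"
  by (cases "quotient_of r") (simp add: is_rat_iff enc_rat_def quotient_of_denom_pos quotient_of_coprime)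

lemma enc_rat_eq_iff: "enc_rat r = c \<longleftrightarrow> is_rat c \<and> dec_rat c = r"
  using enc_dec_rat by auto

lemma computable_bool_is_rat:
  assumes "computable f" shows "computable_bool (\<lambda>x. is_rat (f x))"
  unfolding is_rat_def
  by (intro computable_bool_intros computable_bool_coprime computable_nat_intros computable_nat
      computable_int_uminus computable_int_decode assms)

text \<open>The reduced fraction is found by search: a candidate is accepted if it is in lowest
  terms and agrees with the given fraction after cross-multiplication. No division by a greatest
  common divisor has to be programmed.\<close>

lemma computable_rat_Fract:
  assumes "computable_int a" "computable_int b"
  shows "computable_rat (\<lambda>x. Fract (a x) (b x))"
  unfolding computable_rat_def
proof (rule computable_graph)
  have a: "computable_int (\<lambda>z. a (code_fst z))"
    unfolding computable_int_def by (intro computable_o[OF assms(1)[unfolded computable_int_def]] computable_nat_intros)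
  have b: "computable_int (\<lambda>z. b (code_fst z))"
    unfolding computable_int_def by (intro computable_o[OF assms(2)[unfolded computable_int_def]] computable_nat_intros)
  \<comment> \<open>A zero denominator is treated apart because \<open>Fract i 0\<close> equals
    0.\<close>
  have "enc_rat (Fract i j) = c \<longleftrightarrow> is_rat c \<and>
      (j = 0 \<and> int_decode (code_fst c) = 0 \<or> j \<noteq> 0 \<and> int_decode (code_fst c) * j = i * int_decode (code_snd c))" for i j c
  proof (cases "j = 0")
    case True
    then show ?thesis
      unfolding enc_rat_eq_iff by (auto simp: is_rat_iff dec_rat_def eq_rat)
  next
    case False
    then show ?thesis
      unfolding enc_rat_eq_iff is_rat_iff dec_rat_def using eq_rat(1)[of "int_decode (code_snd c)" j] by auto
  qed
  then show "computable_bool (\<lambda>z. enc_rat (Fract (a (code_fst z)) (b (code_fst z))) = code_snd z)"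
    by (simp only:, intro computable_bool_intros computable_bool_is_rat computable_bool_int_eq
      computable_int_const computable_int_mult computable_int_decode computable_nat_intros a b)
qed

lemma computable_rat_dec: "computable f \<Longrightarrow> computable_rat (\<lambda>x. dec_rat (f x))"
  unfolding dec_rat_def
  by (intro computable_rat_Fract computable_int_decode computable_nat_intros)

lemma computable_rat_const: "computable_rat (\<lambda>_. r)"
  unfolding computable_rat_def by (rule computable_const)

lemma computable_int_num: "computable_rat f \<Longrightarrow> computable_int (\<lambda>x. fst (quotient_of (f x)))"
  and computable_int_den: "computable_rat f \<Longrightarrow> computable_int (\<lambda>x. snd (quotient_of (f x)))"
proof -
  assume f: "computable_rat f"
  have "int_encode (fst (quotient_of (f x))) = code_fst (enc_rat (f x))"
    "int_encode (snd (quotient_of (f x))) = code_snd (enc_rat (f x))" for x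
    by (simp_all add: enc_rat_def split: prod.split)
  then show "computable_int (\<lambda>x. fst (quotient_of (f x)))" "computable_int (\<lambda>x. snd (quotient_of (f x)))"
    using f unfolding computable_int_def computable_rat_def by (simp_all add: computable_code_fst computable_code_snd)
qed

lemma Fract_quotient_of: "r = Fract (fst (quotient_of r)) (snd (quotient_of r))"
  by (metis Fract_of_int_quotient prod.collapse quotient_of_div)

lemma snd_quotient_of_neq_0: "snd (quotient_of r) \<noteq> 0"
  by (metis less_irrefl quotient_of_denom_pos')

lemma computable_rat_add:
  assumes "computable_rat f" "computable_rat g" shows "computable_rat (\<lambda>x. f x + g x)"
proof -
  have "r + s = Fract (fst (quotient_of r) * snd (quotient_of s) + fst (quotient_of s) * snd (quotient_of r))
      (snd (quotient_of r) * snd (quotient_of s))" for r s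
    using add_rat[OF snd_quotient_of_neq_0 snd_quotient_of_neq_0, of "fst (quotient_of r)" r "fst (quotient_of s)" s]
    by (simp only: Fract_quotient_of[symmetric])
  then show ?thesis
    by (simp only:, intro computable_rat_Fract computable_int_add computable_int_mult
        computable_int_num computable_int_den assms)
qed

lemma computable_rat_mult:
  assumes "computable_rat f" "computable_rat g" shows "computable_rat (\<lambda>x. f x * g x)"
proof -
  have "r * s = Fract (fst (quotient_of r) * fst (quotient_of s))
      (snd (quotient_of r) * snd (quotient_of s))" for r s
    using mult_rat[of "fst (quotient_of r)" "snd (quotient_of r)" "fst (quotient_of s)" "snd (quotient_of s)"]
    by (simp only: Fract_quotient_of[symmetric])
  then show ?thesis
    by (simp only:, intro computable_rat_Fract computable_int_mult
        computable_int_num computable_int_den assms)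
qed

lemma computable_bool_rat_le:
  assumes "computable_rat f" "computable_rat g" shows "computable_bool (\<lambda>x. f x \<le> g x)"
proof -
  have "r \<le> s \<longleftrightarrow> fst (quotient_of r) * snd (quotient_of s) \<le> fst (quotient_of s) * snd (quotient_of r)" for r s
    by (simp add: rat_less_eq_code mult.commute split: prod.split)
  then show ?thesis
    by (simp only:, intro computable_bool_int_le computable_int_mult
        computable_int_num computable_int_den assms)
qed

lemma computable_bool_rat_less:
  assumes "computable_rat f" "computable_rat g" shows "computable_bool (\<lambda>x. f x < g x)"
  using computable_bool_not[OF computable_bool_rat_le[OF assms(2,1)]] by (simp add: not_le)

lemma computable_bool_rat_eq:
  assumes "computable_rat f" "computable_rat g" shows "computable_bool (\<lambda>x. f x = g x)"
  using computable_bool_conj[OF computable_bool_rat_le[OF assms] computable_bool_rat_le[OF assms(2,1)]]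
  by (simp add: eq_iff)

lemma computable_rat_sum:
  assumes "computable n" "computable_rat (\<lambda>z. f (code_fst z) (code_snd z))"
  shows "computable_rat (\<lambda>x. \<Sum>i<n x. f x i)"
proof -
  have "rec_nat (enc_rat 0) (\<lambda>i y. enc_rat (dec_rat y + f x i)) m = enc_rat (\<Sum>i<m. f x i)" for x m
    by (induction m) auto
  moreover have "computable (\<lambda>x. rec_nat (enc_rat 0) (\<lambda>i y. enc_rat (dec_rat y + f x i)) (n x))"
  proof (intro computable_rec_nat assms(1) computable_const)
    have "computable_rat (\<lambda>z. f (code_fst z) (code_fst (code_snd z)))"
      using computable_o[OF assms(2)[unfolded computable_rat_def], of "\<lambda>z. prod_encode (code_fst z, code_fst (code_snd z))"]
      unfolding computable_rat_def by (simp add: computable_nat_intros)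
    then have "computable_rat (\<lambda>z. dec_rat (code_snd (code_snd z)) + f (code_fst z) (code_fst (code_snd z)))"
      by (intro computable_rat_add computable_rat_dec computable_nat_intros)
    then show "computable (\<lambda>z. enc_rat (dec_rat (code_snd (code_snd z)) + f (code_fst z) (code_fst (code_snd z))))"
      by (simp add: computable_rat_def)
  qed
  ultimately show ?thesis
    unfolding computable_rat_def by simp
qed

lemmas computable_rat_intros = computable_rat_dec computable_rat_const computable_rat_add
  computable_rat_mult computable_rat_sum computable_bool_rat_le computable_bool_rat_less
  computable_bool_rat_eq

section \<open>Lists coded as numbers\<close>

definition code_drop :: "nat \<Rightarrow> nat \<Rightarrow> nat" where
  "code_drop c i = ((\<lambda>c. code_snd (c - 1)) ^^ i) c"

definition code_nth :: "nat \<Rightarrow> nat \<Rightarrow> nat" where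
  "code_nth c i = code_fst (code_drop c i - 1)"

definition code_length :: "nat \<Rightarrow> nat" where
  "code_length c = (LEAST i. code_drop c i = 0)"

text \<open>A nonempty list has the code \<open>Suc (prod_encode (x, list_encode xs))\<close>, so
  subtracting one and projecting yields the head or the tail.\<close>

lemma code_drop: "code_drop (list_encode xs) i = list_encode (drop i xs)"
proof (induction i arbitrary: xs)
  case 0
  show ?case by (simp add: code_drop_def)
next
  case (Suc i)
  have "code_snd (list_encode xs - 1) = list_encode (tl xs)"
  \<comment> \<open>The empty list has code 0, and this is a fixed point: truncated subtraction
    gives 0 again, which is the code of \<open>(0, 0)\<close>.\<close>
  proof (cases xs)
    case Nil
    then show ?thesis using code_snd_pair[of 0 0] by (simp add: prod_encode_def del: code_snd_pair)
  qed simp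
  then show ?case
    using Suc[of "tl xs"] by (simp add: code_drop_def funpow_Suc_right drop_Suc del: funpow.simps)
qed

lemma list_encode_eq_0_iff: "list_encode xs = 0 \<longleftrightarrow> xs = []"
  by (cases xs) auto

lemma code_nth: "i < length xs \<Longrightarrow> code_nth (list_encode xs) i = xs ! i"
  unfolding code_nth_def code_drop by (subst Cons_nth_drop_Suc[symmetric]) simp_all

lemma code_length: "code_length (list_encode xs) = length xs"
  unfolding code_length_def code_drop list_encode_eq_0_iff
  by (rule Least_equality) auto

lemma code_length_list_decode: "code_length c = length (list_decode c)"
  using code_length[of "list_decode c"] by simp

lemma code_nth_list_decode: "i < code_length c \<Longrightarrow> code_nth c i = list_decode c ! i"
  using code_nth[of i "list_decode c"] code_length_list_decode by simp

lemma computable_code_drop: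
  assumes "computable f" "computable g" shows "computable (\<lambda>x. code_drop (f x) (g x))"
  unfolding code_drop_def
  by (intro computable_funpow[where h="\<lambda>_ c. code_snd (c - 1)"] computable_nat_intros assms)

lemma computable_code_nth:
  assumes "computable f" "computable g" shows "computable (\<lambda>x. code_nth (f x) (g x))"
  unfolding code_nth_def
  by (intro computable_code_drop computable_nat_intros assms)

lemma computable_code_length:
  assumes "computable f" shows "computable (\<lambda>x. code_length (f x))"
proof (rule computable_o[OF _ assms])
  show "computable code_length"
    unfolding code_length_def
  proof (rule computable_Least)
    show "\<exists>i. code_drop c i = 0" for c
      using code_drop[of "list_decode c" "length (list_decode c)"] by auto
  qed (intro computable_bool_intros computable_code_drop computable_nat_intros)
qed

section \<open>Discounted sums and the Bellman equation\<close>

lemma summable_discounted: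
  fixes f :: "nat \<Rightarrow> real"
  assumes "0 < lam" "lam < 1" "\<And>i. \<bar>f i\<bar> \<le> B"
  shows "summable (\<lambda>i. lam ^ i * f i)"
proof (rule summable_comparison_test')
  show "summable (\<lambda>i. B * lam ^ i)"
    using assms by (intro summable_mult summable_geometric) simp
  show "norm (lam ^ i * f i) \<le> B * lam ^ i" if "i \<ge> 0" for i
    using assms(1) mult_right_mono[OF assms(3)[of i], of "lam ^ i"] by (simp add: abs_mult mult.commute)
qed

lemma Disc_unfold:
  assumes "0 < lam" "lam < 1" "\<And>i. \<bar>f i\<bar> \<le> B"
  shows "Disc lam f = f 0 + lam * Disc lam (\<lambda>i. f (Suc i))"
proof -
  have "summable (\<lambda>i. lam ^ i * f (Suc i))"
    using summable_discounted[of lam "\<lambda>i. f (Suc i)"] assms by blast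
  then show ?thesis
    unfolding Disc_def using suminf_split_head[OF summable_discounted[of lam f B, OF assms]]
    by (simp add: suminf_mult mult.assoc)
qed

text \<open>Here \<open>u\<close> is a potential that pays for the weights. Multiplied by
  \<open>lam ^ m\<close>, the local inequalities telescope.\<close>

lemma partial_sum_le_potential:
  fixes u :: "nat \<Rightarrow> real"
  assumes "0 < lam" "\<And>i. f i + lam * u (Suc i) \<le> u i"
  shows "(\<Sum>i<m. lam ^ i * f i) + lam ^ m * u m \<le> u 0"
proof (induction m)
  case (Suc m)
  have "lam ^ m * (f m + lam * u (Suc m)) \<le> lam ^ m * u m"
    using assms by (intro mult_left_mono) auto
  with Suc show ?case by (simp add: algebra_simps)
qed simp

lemma tendsto_discounted_0:
  fixes u :: "nat \<Rightarrow> real"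
  assumes "0 < lam" "lam < 1" "\<And>i. \<bar>u i\<bar> \<le> K"
  shows "(\<lambda>m. lam ^ m * u m) \<longlonglongrightarrow> 0"
  by (rule summable_LIMSEQ_zero[OF summable_discounted[OF assms]])

lemma Disc_le_potential:
  assumes "0 < lam" "lam < 1" "\<And>i. \<bar>f i\<bar> \<le> B" "\<And>i. \<bar>u i\<bar> \<le> K"
    and "\<And>i. f i + lam * u (Suc i) \<le> u i"
  shows "Disc lam f \<le> u 0"
proof -
  have "(\<lambda>m. (\<Sum>i<m. lam ^ i * f i) + lam ^ m * u m) \<longlonglongrightarrow> Disc lam f + 0"
    unfolding Disc_def
    by (intro tendsto_add summable_LIMSEQ[OF summable_discounted] tendsto_discounted_0) (use assms in auto)
  then show ?thesis
    using partial_sum_le_potential[of lam f u, OF assms(1,5)] by (intro LIMSEQ_le_const2) auto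
qed

lemma Disc_uminus:
  assumes "0 < lam" "lam < 1" "\<And>i. \<bar>f i\<bar> \<le> B"
  shows "Disc lam (\<lambda>i. - f i) = - Disc lam f"
  using summable_discounted[of lam f B, OF assms] by (simp add: Disc_def suminf_minus)

lemma Disc_eq_potential:
  assumes "0 < lam" "lam < 1" "\<And>i. \<bar>f i\<bar> \<le> B" "\<And>i. \<bar>u i\<bar> \<le> K"
    and eq: "\<And>i. f i + lam * u (Suc i) = u i"
  shows "Disc lam f = u 0"
proof (rule antisym)
  have "- f i + lam * - u (Suc i) \<le> - u i" for i
    using eq[of i] by simp
  then have "Disc lam (\<lambda>i. - f i) \<le> - u 0"
    using assms(1-4) by (intro Disc_le_potential[of _ _ B "\<lambda>i. - u i" K]) auto
  then show "u 0 \<le> Disc lam f" using Disc_uminus[of lam f B, OF assms(1-3)] by simp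
  show "Disc lam f \<le> u 0"
    using assms(1-4) eq_refl[OF eq] by (rule Disc_le_potential)
qed

lemma abs_Disc_le:
  assumes "0 < lam" "lam < 1" "\<And>i. \<bar>f i\<bar> \<le> B"
  shows "\<bar>Disc lam f\<bar> \<le> B / (1 - lam)"
proof -
  \<comment> \<open>The constant potential \<open>B / (1 - lam)\<close> is the fixed point of
    \<open>B + lam * z\<close>; it is the value of receiving weight \<open>B\<close>
    forever.\<close>
  have u: "B + lam * (B / (1 - lam)) = B / (1 - lam)"
    using assms by (simp add: field_simps)
  have f: "f i + lam * (B / (1 - lam)) \<le> B / (1 - lam)" "- f i + lam * (B / (1 - lam)) \<le> B / (1 - lam)" for i
    using assms(3)[of i] u by linarith+
  have "Disc lam f \<le> B / (1 - lam)"
    by (rule Disc_le_potential[of _ _ B "\<lambda>_. B / (1 - lam)" "\<bar>B / (1 - lam)\<bar>"]) (use assms f in auto)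
  moreover have "Disc lam (\<lambda>i. - f i) \<le> B / (1 - lam)"
    by (rule Disc_le_potential[of _ _ B "\<lambda>_. B / (1 - lam)" "\<bar>B / (1 - lam)\<bar>"]) (use assms f in auto)
  ultimately show ?thesis using Disc_uminus[of lam f B, OF assms] by simp
qed

text \<open>This is the quantitative continuity of the discounted sum: two tails differ by at most
  twice the bound \<open>B / (1 - lam)\<close>, and each common weight scales the difference by
  \<open>lam\<close>.\<close>

lemma Disc_close:
  assumes "0 < lam" "lam < 1" "\<And>i. \<bar>f i\<bar> \<le> B" "\<And>i. \<bar>g i\<bar> \<le> B" "\<And>i. i < m \<Longrightarrow> f i = g i"
  shows "\<bar>Disc lam f - Disc lam g\<bar> \<le> lam ^ m * (2 * B / (1 - lam))"
  using assms(3-)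
proof (induction m arbitrary: f g)
  case 0
  then show ?case
    using abs_Disc_le[OF assms(1,2), of f B] abs_Disc_le[OF assms(1,2), of g B] by simp
next
  case (Suc m)
  have "\<bar>Disc lam f - Disc lam g\<bar> = lam * \<bar>Disc lam (\<lambda>i. f (Suc i)) - Disc lam (\<lambda>i. g (Suc i))\<bar>"
    using Suc.prems Disc_unfold[OF assms(1,2), of f B] Disc_unfold[OF assms(1,2), of g B] assms(1)
    by (simp add: abs_mult right_diff_distrib[symmetric])
  also have "\<dots> \<le> lam * (lam ^ m * (2 * B / (1 - lam)))"
    using Suc.prems assms(1) by (intro mult_left_mono Suc.IH) auto
  finally show ?case by simp
qed

section \<open>Rational optimal values from positional policies\<close>

lemma exists_arg_max:
  fixes f :: "'a \<Rightarrow> real"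
  assumes "finite S" "S \<noteq> {}"
  shows "\<exists>x\<in>S. \<forall>y\<in>S. f y \<le> f x"
proof -
  have "Max (f ` S) \<in> f ` S"
    using assms by (intro Max_in) auto
  then obtain x where "x \<in> S" "f x = Max (f ` S)" by auto
  then show ?thesis using assms by (intro bexI[of _ x]) auto
qed

text \<open>Along a positional policy the successors of a state become periodic, and the value at a
  state of the cycle solves a linear equation with rational coefficients.\<close>

lemma policy_value_rational:
  fixes V c :: "nat \<Rightarrow> real"
  assumes Q: "finite Q" and s: "\<And>q. q \<in> Q \<Longrightarrow> s q \<in> Q" and c: "\<And>q. q \<in> Q \<Longrightarrow> c q \<in> \<rat>"
    and lam: "0 < lam" "lam < 1" "lam \<in> \<rat>"
    and V: "\<And>q. q \<in> Q \<Longrightarrow> V q = c q + lam * V (s q)" and q: "q \<in> Q"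
  shows "V q \<in> \<rat>"
proof -
  have orbit: "(s ^^ m) p \<in> Q" if "p \<in> Q" for m p
    by (induction m) (auto simp: that s)
  have unfold: "\<exists>C\<in>\<rat>. V p = C + lam ^ m * V ((s ^^ m) p)" if "p \<in> Q" for m p
  proof (induction m)
    case 0
    show ?case by (rule bexI[of _ 0]) auto
  next
    case (Suc m)
    then obtain C where C: "C \<in> \<rat>" "V p = C + lam ^ m * V ((s ^^ m) p)" by blast
    show ?case
    proof (rule bexI[of _ "C + lam ^ m * c ((s ^^ m) p)"])
      show "V p = C + lam ^ m * c ((s ^^ m) p) + lam ^ Suc m * V ((s ^^ Suc m) p)"
        using V[OF orbit[OF that, of m]] C(2) by (simp add: algebra_simps)
      show "C + lam ^ m * c ((s ^^ m) p) \<in> \<rat>"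
        using C(1) c[OF orbit[OF that]] lam(3) by simp
    qed
  qed
  \<comment> \<open>Pigeonhole: the orbit of \<open>q\<close> stays in the finite set
    \<open>Q\<close>, hence some state \<open>p\<close> on it recurs.\<close>
  have "\<not> inj_on (\<lambda>m. (s ^^ m) q) UNIV"
  proof
    assume "inj_on (\<lambda>m. (s ^^ m) q) UNIV"
    moreover have "finite ((\<lambda>m. (s ^^ m) q) ` UNIV)"
      using orbit[OF q] by (intro finite_subset[OF _ Q]) auto
    ultimately show False using finite_imageD infinite_UNIV_nat by blast
  qed
  then obtain i j where ij: "i < j" "(s ^^ i) q = (s ^^ j) q"
    unfolding inj_on_def by (metis linorder_neqE_nat)
  define p where "p = (s ^^ i) q"
  have p: "p \<in> Q" "(s ^^ (j - i)) p = p"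
    using orbit[OF q] ij funpow_add[of "j - i" i s] unfolding p_def by (simp_all add: fun_eq_iff)
  obtain C where C: "C \<in> \<rat>" "V p = C + lam ^ (j - i) * V p"
    using unfold[OF p(1), of "j - i"] p(2) by auto
  \<comment> \<open>The cycle has positive length, so the coefficient
    \<open>1 - lam ^ (j - i)\<close> of the linear equation for \<open>V p\<close> is
    nonzero.\<close>
  have "lam ^ (j - i) < 1"
    using lam ij power_Suc_less_one[of lam "j - Suc i"] by (simp add: Suc_diff_Suc del: power_Suc)
  with C have "V p = C / (1 - lam ^ (j - i))"
    by (simp add: field_simps)
  then have "V p \<in> \<rat>"
    using C(1) lam(3) by simp
  then show ?thesis
    using unfold[OF q, of i] lam(3) unfolding p_def by auto
qed

text \<open>Among the finitely many positional policies, one that maximises the sum of all values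
  cannot be improved locally, so its value solves the optimality equation.\<close>

lemma bellman_solution_exists:
  fixes E :: "nat \<Rightarrow> 'e set" and t :: "'e \<Rightarrow> nat" and c :: "nat \<Rightarrow> 'e \<Rightarrow> real"
  assumes Q: "finite Q" and E: "\<And>q. q \<in> Q \<Longrightarrow> finite (E q) \<and> E q \<noteq> {}"
    and t: "\<And>q e. q \<in> Q \<Longrightarrow> e \<in> E q \<Longrightarrow> t e \<in> Q"
    and c: "\<And>q e. q \<in> Q \<Longrightarrow> e \<in> E q \<Longrightarrow> c q e \<in> \<rat>"
    and lam: "0 < lam" "lam < 1" "lam \<in> \<rat>"
  shows "\<exists>v. \<forall>q\<in>Q. v q \<in> \<rat> \<and> (\<forall>e\<in>E q. c q e + lam * v (t e) \<le> v q) \<and>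
    (\<exists>e\<in>E q. v q = c q e + lam * v (t e))"
proof (cases "Q = {}")
  case False
  define v where "v s q = Disc lam (\<lambda>i. c (((\<lambda>q. t (s q)) ^^ i) q) (s (((\<lambda>q. t (s q)) ^^ i) q)))" for s q
  have v: "v s q = c q (s q) + lam * v s (t (s q))" if s: "s \<in> Pi\<^sub>E Q E" and q: "q \<in> Q" for s q
  proof -
    define B where "B = (\<Sum>q\<in>Q. \<bar>c q (s q)\<bar>)"
    have "((\<lambda>q. t (s q)) ^^ i) q \<in> Q" for i
      using q by (induction i) (auto simp: t[OF _ PiE_mem[OF s]])
    then have B: "\<bar>c (((\<lambda>q. t (s q)) ^^ i) q) (s (((\<lambda>q. t (s q)) ^^ i) q))\<bar> \<le> B" for i
      unfolding B_def by (intro member_le_sum[of _ _ "\<lambda>q. \<bar>c q (s q)\<bar>"] Q) auto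
    show ?thesis
      unfolding v_def by (subst Disc_unfold[OF lam(1,2) B]) (simp add: funpow_Suc_right del: funpow.simps(2))
  qed
  have "finite (Pi\<^sub>E Q E)" "Pi\<^sub>E Q E \<noteq> {}"
    using Q E by (auto intro!: finite_PiE simp: PiE_eq_empty_iff)
  from exists_arg_max[OF this, of "\<lambda>s. \<Sum>q\<in>Q. v s q"] obtain s where s: "s \<in> Pi\<^sub>E Q E"
    and max: "\<And>s'. s' \<in> Pi\<^sub>E Q E \<Longrightarrow> (\<Sum>q\<in>Q. v s' q) \<le> (\<Sum>q\<in>Q. v s q)" by blast
  have "\<forall>q\<in>Q. \<exists>e\<in>E q. \<forall>e'\<in>E q. c q e' + lam * v s (t e') \<le> c q e + lam * v s (t e)"
    by (intro ballI exists_arg_max) (simp_all add: E)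
  then obtain g where g: "\<And>q. q \<in> Q \<Longrightarrow> g q \<in> E q"
    "\<And>q e. q \<in> Q \<Longrightarrow> e \<in> E q \<Longrightarrow> c q e + lam * v s (t e) \<le> c q (g q) + lam * v s (t (g q))"
    by metis
  define s' where "s' = restrict g Q"
  have s': "s' \<in> Pi\<^sub>E Q E" "\<And>q. q \<in> Q \<Longrightarrow> s' q = g q"
    using g(1) by (auto simp: s'_def)
  \<comment> \<open>The one-step advantage of the greedy edge over the edge chosen by
    \<open>s\<close>, both continued with the values of \<open>s\<close>.\<close>
  define gain where "gain q = c q (g q) + lam * v s (t (g q)) - v s q" for q
  have gain: "gain q \<ge> 0" if "q \<in> Q" for q
    using g(2)[OF that PiE_mem[OF s that]] v[OF s that] by (simp add: gain_def)
  \<comment> \<open>The improvement by the greedy policy is itself a discounted sum, namely of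
    \<open>gain\<close> along the greedy path.\<close>
  define d where "d q = v s' q - v s q" for q
  have d: "d q = gain q + lam * d (t (g q))" if "q \<in> Q" for q
    using v[OF s'(1) that] s'(2)[OF that] by (simp add: d_def gain_def algebra_simps)
  \<comment> \<open>Minimum principle: at a state where \<open>d\<close> is smallest the recursion
    gives \<open>d p \<ge> lam * d p\<close>, so \<open>d\<close> is nowhere negative.\<close>
  obtain p where p: "p \<in> Q" "\<And>q. q \<in> Q \<Longrightarrow> d p \<le> d q"
    using exists_arg_max[OF Q False, of "\<lambda>q. - d q"] by auto
  have "d p \<ge> lam * d p"
    using d[OF p(1)] gain[OF p(1)] lam(1)
      mult_left_mono[OF p(2)[OF t[OF p(1) g(1)[OF p(1)]]], of lam] by linarith
  then have "(1 - lam) * d p \<ge> 0"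
    by (simp add: algebra_simps)
  with lam have "d p \<ge> 0"
    by (simp add: zero_le_mult_iff)
  then have d_nonneg: "d q \<ge> 0" if "q \<in> Q" for q
    using p(2)[OF that] by simp
  \<comment> \<open>Since \<open>s\<close> maximises the total value, the nonnegative improvements
    sum to at most zero and all vanish. Then so does \<open>gain\<close>, and the edges of
    \<open>s\<close> are already greedy.\<close>
  have "(\<Sum>q\<in>Q. d q) \<le> 0"
    using max[OF s'(1)] by (simp add: d_def sum_subtractf)
  with d_nonneg have "d q = 0" if "q \<in> Q" for q
    using that Q sum_nonneg_eq_0_iff[of Q d] sum_nonneg[of Q d] by force
  then have gain_0: "gain q = 0" if "q \<in> Q" for q
    using d[OF that] that t[OF that g(1)[OF that]] by simp
  have "v s q \<in> \<rat>" if "q \<in> Q" for q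
    by (rule policy_value_rational[of Q "\<lambda>q. t (s q)" "\<lambda>q. c q (s q)" lam "v s" q, OF Q _ _ lam v[OF s] that])
       (auto intro: t c PiE_mem[OF s])
  with gain_0 g show ?thesis
    by (intro exI[of _ "v s"]) (force simp: gain_def)
qed auto

section \<open>The measure on runs\<close>

lemma pmf_of_weights:
  fixes f :: "nat \<Rightarrow> real"
  assumes "\<And>x. 0 \<le> f x" "\<And>x. n \<le> x \<Longrightarrow> f x = 0" "(\<Sum>x<n. f x) = 1"
  shows "\<exists>p. pmf p = f"
proof -
  have "(\<integral>\<^sup>+x. ennreal (f x) \<partial>count_space UNIV) = (\<Sum>x<n. ennreal (f x))"
    using assms(2) by (intro nn_integral_count_space'[of "{..<n}", THEN trans]) (auto simp: not_less)
  also have "\<dots> = 1"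
    using assms by (subst sum_ennreal) auto
  finally show ?thesis
    using pmf_embed_pmf[of f] assms(1) by blast
qed

text \<open>The run is driven by independent choices \<open>\<omega> (i, q)\<close>: the state visited at time \<open>i\<close> if the
  state at time \<open>i - 1\<close> is \<open>q\<close> (the initial state for \<open>i = 0\<close>, where \<open>q\<close> is irrelevant).\<close>

fun driven_run :: "(nat \<times> nat \<Rightarrow> nat) \<Rightarrow> nat \<Rightarrow> nat" where
  "driven_run \<omega> 0 = \<omega> (0, 0)"
| "driven_run \<omega> (Suc i) = \<omega> (Suc i, driven_run \<omega> i)"

text \<open>Once the prefix \<open>x\<close> is prescribed, the state before each step is known. The
  event then constrains finitely many fixed coordinates instead of coordinates selected at
  random.\<close>

lemma driven_run_prefix_iff:
  "(\<forall>i<m. driven_run \<omega> i = x i) \<longleftrightarrow> (\<forall>i<m. \<omega> (i, case i of 0 \<Rightarrow> 0 | Suc j \<Rightarrow> x j) = x i)"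
proof (induction m)
  case (Suc m)
  then show ?case
    by (cases m) (auto simp: less_Suc_eq)
qed simp

text \<open>The measure is the image of a product of independent choices, one for each time and each
  possible current state, under the map that reads off the driven run.\<close>

lemma markov_measure_exists:
  fixes p :: "nat \<times> nat \<Rightarrow> nat pmf"
  shows "\<exists>M. sets M = sets (stream_space (count_space UNIV)) \<and> prob_space M \<and>
    (\<forall>qs. qs \<noteq> [] \<longrightarrow> emeasure M {r \<in> space M. stake (length qs) r = qs} =
       ennreal (\<Prod>i<length qs. pmf (p (i, case i of 0 \<Rightarrow> 0 | Suc j \<Rightarrow> qs ! j)) (qs ! i)))"
proof -
  define N where "N = Pi\<^sub>M (UNIV :: (nat \<times> nat) set) (\<lambda>k. measure_pmf (p k))"
  interpret product_prob_space "\<lambda>k. measure_pmf (p k)" "UNIV :: (nat \<times> nat) set"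
    by (standard) 
  interpret N: prob_space N
    unfolding N_def by (rule prob_space_PiM) (rule prob_space_measure_pmf)
  have coord: "(\<lambda>\<omega>. \<omega> k) \<in> N \<rightarrow>\<^sub>M count_space UNIV" for k
    using measurable_component_singleton[of k UNIV "\<lambda>k. measure_pmf (p k)"] by (simp add: N_def)
  have run: "(\<lambda>\<omega>. driven_run \<omega> i) \<in> N \<rightarrow>\<^sub>M count_space UNIV" for i
  proof (induction i)
    case (Suc i)
    show ?case
      using measurable_compose_countable[of "\<lambda>q \<omega>. \<omega> (Suc i, q)", OF coord Suc] by simp
  qed (simp add: coord)
  define M where "M = distr N (stream_space (count_space UNIV)) (\<lambda>\<omega>. to_stream (driven_run \<omega>))"
  have meas: "(\<lambda>\<omega>. to_stream (driven_run \<omega>)) \<in> N \<rightarrow>\<^sub>M stream_space (count_space UNIV)"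
    by (rule measurable_stream_space2) (simp add: to_stream_def run)
  have sp: "space N = UNIV"
    by (simp add: N_def space_PiM)
  have sM: "space M = UNIV"
    by (simp add: M_def space_stream_space)
  have "emeasure M {r \<in> space M. stake (length qs) r = qs} =
       ennreal (\<Prod>i<length qs. pmf (p (i, case i of 0 \<Rightarrow> 0 | Suc j \<Rightarrow> qs ! j)) (qs ! i))" for qs
  proof -
    define key where "key i = (i, case i of 0 \<Rightarrow> 0 | Suc j \<Rightarrow> qs ! j)" for i :: nat
    \<comment> \<open>Each coordinate carries its time, so the coordinates stay distinct even if the
      prefix revisits a state, and the product over them is a product over times.\<close>
    have inj: "inj_on key {..<length qs}"
      by (auto simp: inj_on_def key_def)
    have "{r \<in> space M. stake (length qs) r = qs} = {r \<in> space (stream_space (count_space UNIV)). \<forall>i<length qs. r !! i = qs ! i}"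
      by (auto simp: list_eq_iff_nth_eq sM space_stream_space)
    also have "emeasure M \<dots> = emeasure N {\<omega> \<in> space N. \<forall>i<length qs. driven_run \<omega> i = qs ! i}"
    proof -
      have "{r \<in> space (stream_space (count_space UNIV)). \<forall>i<length qs. r !! i = qs ! i}
          \<in> sets (stream_space (count_space UNIV))"
        by measurable
      then show ?thesis
        unfolding M_def
        by (subst emeasure_distr[OF meas]) (auto simp: to_stream_def space_stream_space intro!: arg_cong[of _ _ "emeasure N"])
    qed
    also have "{\<omega> \<in> space N. \<forall>i<length qs. driven_run \<omega> i = qs ! i} =
        {\<omega> \<in> space N. \<forall>k\<in>key ` {..<length qs}. \<omega> k \<in> {qs ! fst k}}"
      unfolding driven_run_prefix_iff by (auto simp: key_def)
    also have "emeasure N \<dots> = (\<Prod>k\<in>key ` {..<length qs}. emeasure (measure_pmf (p k)) {qs ! fst k})"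
      unfolding N_def by (rule emeasure_PiM_Collect) auto
    also have "\<dots> = (\<Prod>i<length qs. ennreal (pmf (p (key i)) (qs ! i)))"
      by (subst prod.reindex[OF inj]) (simp add: emeasure_pmf_single key_def)
    also have "\<dots> = ennreal (\<Prod>i<length qs. pmf (p (key i)) (qs ! i))"
      by (rule prod_ennreal) simp
    finally show ?thesis by (simp add: key_def)
  qed
  moreover have "prob_space M"
    unfolding M_def by (rule N.prob_space_distr[OF meas])
  ultimately show ?thesis
    by (intro exI[of _ M]) (auto simp: M_def)
qed

text \<open>Prefix events determine a probability measure on streams; this is the uniqueness half
  that the definite description in \<open>run_measure\<close> requires.\<close>

lemma stream_measure_eqI:
  fixes M N :: "'a :: countable stream measure"
  assumes "sets M = sets (stream_space (count_space UNIV))" "sets N = sets (stream_space (count_space UNIV))"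
    and "prob_space M" "prob_space N"
    and "\<And>xs. xs \<noteq> [] \<Longrightarrow> emeasure M {r \<in> space M. stake (length xs) r = xs} =
      emeasure N {r \<in> space N. stake (length xs) r = xs}"
  shows "M = N"
proof (rule stream_space_eq_sstart[of UNIV])
  have "space M = UNIV" "space N = UNIV"
    using assms(1,2)[THEN sets_eq_imp_space_eq] by (simp_all add: space_stream_space)
  moreover have "sstart UNIV xs = {r. stake (length xs) r = xs}" for xs :: "'a list"
    by (auto simp: sstart_eq list_eq_iff_nth_eq)
  ultimately show "emeasure M (sstart UNIV xs) = emeasure N (sstart UNIV xs)" if "xs \<noteq> []" for xs
    using assms(5)[OF that] by simp
qed (use assms in auto)

lemma pwa_valid_init:
  assumes "pwa_valid A"
  shows "0 \<le> pwa_init A q" "pwa_n A \<le> q \<Longrightarrow> pwa_init A q = 0" "(\<Sum>q<pwa_n A. pwa_init A q) = 1"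
proof -
  obtain n k i d g where A: "A = (n, k, i, d, g)" by (cases A)
  have "(\<Sum>q<n. real_of_rat (i ! q)) = real_of_rat (\<Sum>q<n. i ! q)"
    by (simp add: of_rat_sum)
  then show "0 \<le> pwa_init A q" "pwa_n A \<le> q \<Longrightarrow> pwa_init A q = 0" "(\<Sum>q<pwa_n A. pwa_init A q) = 1"
    using assms by (auto simp: A)
qed

lemma pwa_valid_delta:
  assumes "pwa_valid A"
  shows "0 \<le> pwa_delta A q a q'" "pwa_n A \<le> q' \<Longrightarrow> pwa_delta A q a q' = 0"
    "pwa_n A \<le> q \<Longrightarrow> pwa_delta A q a q' = 0"
    "q < pwa_n A \<Longrightarrow> a < pwa_k A \<Longrightarrow> (\<Sum>q'<pwa_n A. pwa_delta A q a q') = 1"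
proof -
  obtain n k i d g where A: "A = (n, k, i, d, g)" by (cases A)
  have "(\<Sum>q'<n. real_of_rat (d ! q ! a ! q')) = real_of_rat (\<Sum>q'<n. d ! q ! a ! q')"
    by (simp add: of_rat_sum)
  then show "0 \<le> pwa_delta A q a q'" "pwa_n A \<le> q' \<Longrightarrow> pwa_delta A q a q' = 0"
    "pwa_n A \<le> q \<Longrightarrow> pwa_delta A q a q' = 0"
    "q < pwa_n A \<Longrightarrow> a < pwa_k A \<Longrightarrow> (\<Sum>q'<pwa_n A. pwa_delta A q a q') = 1"
    using assms by (auto simp: A)
qed

lemma prefix_prob_snoc:
  "qs \<noteq> [] \<Longrightarrow> prefix_prob A w (qs @ [q]) = prefix_prob A w qs * pwa_delta A (last qs) (w !! (length qs - 1)) q"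
  unfolding prefix_prob_def
  by (cases qs rule: rev_cases) (auto simp: nth_append hd_append intro!: prod.cong)

lemma run_measure_props:
  assumes A: "pwa_valid A" and w: "sset w \<subseteq> {..<pwa_k A}"
  shows "sets (run_measure A w) = sets (stream_space (count_space UNIV))"
    and "prob_space (run_measure A w)"
    and "\<And>qs. qs \<noteq> [] \<Longrightarrow> emeasure (run_measure A w) {r \<in> space (run_measure A w). stake (length qs) r = qs}
      = ennreal (prefix_prob A w qs)"
proof -
  let ?P = "\<lambda>M. sets M = sets (stream_space (count_space UNIV)) \<and> prob_space M \<and>
     (\<forall>qs. qs \<noteq> [] \<longrightarrow> emeasure M {r \<in> space M. stake (length qs) r = qs} = ennreal (prefix_prob A w qs))"
  obtain p0 where p0: "pmf p0 = pwa_init A"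
    using pmf_of_weights[of "pwa_init A" "pwa_n A"] pwa_valid_init[OF A] by blast
  have "\<forall>q i. \<exists>p. q < pwa_n A \<longrightarrow> pmf p = pwa_delta A q (w !! i)"
  proof (intro allI)
    fix q i
    have "w !! i < pwa_k A" using w by (auto simp: sset_range)
    then show "\<exists>p. q < pwa_n A \<longrightarrow> pmf p = pwa_delta A q (w !! i)"
      using pmf_of_weights[of "pwa_delta A q (w !! i)" "pwa_n A"] pwa_valid_delta[OF A] by metis
  qed
  then obtain tr where tr: "\<And>q i. q < pwa_n A \<Longrightarrow> pmf (tr q i) = pwa_delta A q (w !! i)"
    by metis
  \<comment> \<open>Outside the state range \<open>p0\<close> serves as a default, as
    \<open>pwa_delta\<close> is no distribution there. The products still agree with
    \<open>prefix_prob\<close>, because a prefix ending in such a state already has probability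
    zero.\<close>
  define p where "p k = (case k of (0, _) \<Rightarrow> p0 | (Suc i, q) \<Rightarrow> if q < pwa_n A then tr q i else p0)" for k
  have prod: "(\<Prod>i<length qs. pmf (p (i, case i of 0 \<Rightarrow> 0 | Suc j \<Rightarrow> qs ! j)) (qs ! i)) = prefix_prob A w qs"
    if "qs \<noteq> []" for qs
    using that
  proof (induction qs rule: rev_nonempty_induct)
    case (single q)
    show ?case by (simp add: prefix_prob_def p_def p0)
  next
    case (snoc q qs)
    then obtain m where m: "length qs = Suc m" by (cases qs) auto
    have "(\<Prod>i<length qs. pmf (p (i, case i of 0 \<Rightarrow> 0 | Suc j \<Rightarrow> (qs @ [q]) ! j)) ((qs @ [q]) ! i)) = prefix_prob A w qs"
      unfolding snoc.IH[symmetric]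
      by (intro prod.cong) (auto simp: nth_append split: nat.splits)
    moreover have "prefix_prob A w qs = 0" if "\<not> qs ! m < pwa_n A"
    proof (cases m)
      case 0
      with that m snoc show ?thesis
        by (auto simp: prefix_prob_def pwa_valid_init[OF A] hd_conv_nth)
    next
      case (Suc m')
      with that m show ?thesis
        by (auto simp: prefix_prob_def pwa_valid_delta[OF A] intro!: bexI[of _ m'])
    qed
    ultimately show ?case
      using snoc.hyps m by (simp add: prefix_prob_snoc nth_append last_conv_nth p_def tr)
  qed
  obtain M where M: "?P M"
    using markov_measure_exists[of p] prod by auto
  have "?P (run_measure A w)"
    unfolding run_measure_def
  proof (rule theI[of ?P, OF M])
    show "N = M" if "?P N" for N
      using that M by (intro stream_measure_eqI) simp_all
  qed
  then show "sets (run_measure A w) = sets (stream_space (count_space UNIV))"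
    and "prob_space (run_measure A w)"
    and "\<And>qs. qs \<noteq> [] \<Longrightarrow> emeasure (run_measure A w) {r \<in> space (run_measure A w). stake (length qs) r = qs}
      = ennreal (prefix_prob A w qs)"
    by blast+
qed

section \<open>Positive and almost-sure values\<close>

declare snth.simps(2) [simp del] stake.simps(2) [simp del]

lemma stake_Suc_neq_Nil [simp]: "stake (Suc m) r \<noteq> []"
  by (metis length_stake list.size(3) nat.simps(3))

lemma prefix_prob_pos_iff:
  assumes "pwa_valid A" "qs \<noteq> []"
  shows "0 < prefix_prob A w qs \<longleftrightarrow>
    0 < pwa_init A (hd qs) \<and> (\<forall>i<length qs - 1. 0 < pwa_delta A (qs ! i) (w !! i) (qs ! Suc i))"
proof -
  have "0 \<le> (\<Prod>i<length qs - 1. pwa_delta A (qs ! i) (w !! i) (qs ! Suc i))"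
    by (intro prod_nonneg pwa_valid_delta[OF assms(1)])
  moreover have "(\<Prod>i<length qs - 1. pwa_delta A (qs ! i) (w !! i) (qs ! Suc i)) \<noteq> 0 \<longleftrightarrow>
      (\<forall>i<length qs - 1. 0 < pwa_delta A (qs ! i) (w !! i) (qs ! Suc i))"
    using pwa_valid_delta(1)[OF assms(1)] by (auto simp: less_le)
  ultimately show ?thesis
    unfolding prefix_prob_def using pwa_valid_init(1)[OF assms(1), of "hd qs"]
    by (simp add: zero_less_mult_iff less_le)
qed

definition legal_run :: "pwa \<Rightarrow> nat stream \<Rightarrow> nat stream \<Rightarrow> bool" where
  "legal_run A w r \<longleftrightarrow> 0 < pwa_init A (r !! 0) \<and> (\<forall>i. 0 < pwa_delta A (r !! i) (w !! i) (r !! Suc i))"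

lemma legal_run_iff_prefix_prob:
  assumes "pwa_valid A"
  shows "legal_run A w r \<longleftrightarrow> (\<forall>m. 0 < prefix_prob A w (stake (Suc m) r))"
proof -
  have "0 < prefix_prob A w (stake (Suc m) r) \<longleftrightarrow>
      0 < pwa_init A (r !! 0) \<and> (\<forall>i<m. 0 < pwa_delta A (r !! i) (w !! i) (r !! Suc i))" for m
    using prefix_prob_pos_iff[OF assms, of "stake (Suc m) r" w]
    by (simp add: hd_conv_nth del: snth.simps(1))
  then show ?thesis
    unfolding legal_run_def by (metis lessI)
qed

lemma legal_run_states:
  assumes "pwa_valid A" "legal_run A w r"
  shows "r !! i < pwa_n A"
  using assms(2) pwa_valid_delta(3)[OF assms(1), of "r !! i" "w !! i" "r !! Suc i"]
  unfolding legal_run_def by (metis less_irrefl not_less)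

text \<open>A run that is not legal has a finite prefix of probability zero, and there are only
  countably many finite prefixes.\<close>

lemma AE_legal_run:
  assumes A: "pwa_valid A" and w: "sset w \<subseteq> {..<pwa_k A}"
  shows "AE r in run_measure A w. legal_run A w r"
proof -
  note M = run_measure_props[OF A w]
  let ?M = "run_measure A w"
  have sp: "space ?M = UNIV"
    using M(1)[THEN sets_eq_imp_space_eq] by (simp add: space_stream_space)
  have "AE r in ?M. \<not> (qs \<noteq> [] \<and> prefix_prob A w qs \<le> 0 \<and> stake (length qs) r = qs)" for qs
  proof (cases "qs \<noteq> [] \<and> prefix_prob A w qs \<le> 0")
    case True
    have "{r \<in> space ?M. stake (length qs) r = qs} = {r \<in> space (stream_space (count_space UNIV)). \<forall>i<length qs. r !! i = qs ! i}"
      by (auto simp: list_eq_iff_nth_eq sp space_stream_space)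
    also have "\<dots> \<in> sets (stream_space (count_space UNIV))"
      by measurable
    finally have "{r \<in> space ?M. stake (length qs) r = qs} \<in> sets ?M"
      by (simp add: M(1))
    moreover have "emeasure ?M {r \<in> space ?M. stake (length qs) r = qs} = 0"
      using True M(3)[of qs] by (simp add: ennreal_neg)
    ultimately have "{r \<in> space ?M. stake (length qs) r = qs} \<in> null_sets ?M" by blast
    then show ?thesis by (rule AE_I') auto
  qed auto
  then have "AE r in ?M. \<forall>qs. \<not> (qs \<noteq> [] \<and> prefix_prob A w qs \<le> 0 \<and> stake (length qs) r = qs)"
    by (simp add: AE_all_countable)
  then show ?thesis
  proof eventually_elim
    case (elim r)
    show ?case
      unfolding legal_run_iff_prefix_prob[OF A]
    proof
      fix m
      show "0 < prefix_prob A w (stake (Suc m) r)"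
        using elim[rule_format, of "stake (Suc m) r"] by auto
    qed
  qed
qed

lemma pwa_gamma_bounded:
  obtains B where "\<And>q a q'. \<bar>pwa_gamma A q a q'\<bar> \<le> B"
proof
  fix q a q'
  \<comment> \<open>The inserted 0 covers arguments out of range, where \<open>pwa_gamma\<close> is
    0 by definition.\<close>
  let ?S = "insert 0 ((\<lambda>(q, a, q'). \<bar>pwa_gamma A q a q'\<bar>) ` ({..<pwa_n A} \<times> {..<pwa_k A} \<times> {..<pwa_n A}))"
  obtain n k i d g where A: "A = (n, k, i, d, g)" by (cases A)
  have "\<bar>pwa_gamma A q a q'\<bar> \<in> ?S"
  proof (cases "q < n \<and> a < k \<and> q' < n")
    case True
    then have "(\<lambda>(q, a, q'). \<bar>pwa_gamma A q a q'\<bar>) (q, a, q') \<in> ?S"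
      by (intro insertI2 imageI) (auto simp: A)
    then show ?thesis by simp
  qed (auto simp: A)
  then show "\<bar>pwa_gamma A q a q'\<bar> \<le> Max ?S"
    by (intro Max_ge) auto
qed

lemma Disc_run_weights_measurable:
  "(\<lambda>r. Disc lam (run_weights A w r)) \<in> borel_measurable (stream_space (count_space UNIV))"
proof -
  have "(\<lambda>r. pwa_gamma A (r !! i) (w !! i) (r !! Suc i)) \<in> borel_measurable (stream_space (count_space UNIV))" for i
  proof (rule measurable_compose_countable[of "\<lambda>q r. pwa_gamma A q (w !! i) (r !! Suc i)"])
    fix q
    show "(\<lambda>r. pwa_gamma A q (w !! i) (r !! Suc i)) \<in> borel_measurable (stream_space (count_space UNIV))"
      by (rule measurable_compose[OF measurable_snth]) simp
  qed (rule measurable_snth)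
  then show ?thesis
    unfolding Disc_def run_weights_def by (intro borel_measurable_suminf borel_measurable_times borel_measurable_const)
qed

lemma run_measure_Disc_sets:
  assumes "pwa_valid A" "sset w \<subseteq> {..<pwa_k A}"
  shows "{r \<in> space (run_measure A w). \<eta> \<le> Disc lam (run_weights A w r)} \<in> sets (run_measure A w)"
    and "{r \<in> space (run_measure A w). Disc lam (run_weights A w r) < \<eta>} \<in> sets (run_measure A w)"
proof -
  have "(\<lambda>r. Disc lam (run_weights A w r)) \<in> borel_measurable (run_measure A w)"
    using Disc_run_weights_measurable measurable_cong_sets[OF run_measure_props(1)[OF assms] refl] by blast
  then show "{r \<in> space (run_measure A w). \<eta> \<le> Disc lam (run_weights A w r)} \<in> sets (run_measure A w)"
    and "{r \<in> space (run_measure A w). Disc lam (run_weights A w r) < \<eta>} \<in> sets (run_measure A w)"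
    by measurable
qed

text \<open>By continuity \<open>X\<close> contains the cylinder of a sufficiently long prefix of
  \<open>r\<close>, and legality gives this cylinder positive probability. The run \<open>r\<close>
  alone may be a null set.\<close>

lemma Disc_near_legal_run_pos:
  assumes A: "pwa_valid A" and w: "sset w \<subseteq> {..<pwa_k A}" and lam: "0 < lam" "lam < 1"
    and r: "legal_run A w r" and "0 < e"
    and X: "X \<in> sets (run_measure A w)"
      "\<And>r'. \<bar>Disc lam (run_weights A w r') - Disc lam (run_weights A w r)\<bar> < e \<Longrightarrow> r' \<in> X"
  shows "0 < measure (run_measure A w) X"
proof -
  note M = run_measure_props[OF A w]
  interpret prob_space "run_measure A w" by (rule M(2))
  obtain B where B: "\<And>q a q'. \<bar>pwa_gamma A q a q'\<bar> \<le> B" by (rule pwa_gamma_bounded[of A]) blast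
  have "(\<lambda>m. lam ^ m * (2 * B / (1 - lam))) \<longlonglongrightarrow> 0"
    using lam by (intro tendsto_mult_left_zero LIMSEQ_power_zero) auto
  from order_tendstoD(2)[OF this \<open>0 < e\<close>] obtain m where m: "lam ^ m * (2 * B / (1 - lam)) < e"
    by (auto simp: eventually_sequentially)
  \<comment> \<open>A weight depends on two consecutive states, so \<open>Suc m\<close> common
    states secure \<open>m\<close> common weights.\<close>
  let ?C = "{r' \<in> space (run_measure A w). stake (length (stake (Suc m) r)) r' = stake (Suc m) r}"
  have "r' \<in> X" if "stake (Suc m) r' = stake (Suc m) r" for r'
  proof (rule X(2))
    have "r' !! i = r !! i" if "i < Suc m" for i
      using \<open>stake (Suc m) r' = stake (Suc m) r\<close> that by (metis stake_nth)
    then have "\<bar>Disc lam (run_weights A w r') - Disc lam (run_weights A w r)\<bar> \<le> lam ^ m * (2 * B / (1 - lam))"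
      using lam B by (intro Disc_close) (auto simp: run_weights_def)
    then show "\<bar>Disc lam (run_weights A w r') - Disc lam (run_weights A w r)\<bar> < e" using m by simp
  qed
  then have "?C \<subseteq> X" by auto
  then have "emeasure (run_measure A w) ?C \<le> emeasure (run_measure A w) X"
    using X(1) by (rule emeasure_mono)
  moreover have "emeasure (run_measure A w) ?C > 0"
    using r unfolding legal_run_iff_prefix_prob[OF A] by (subst M(3)) auto
  ultimately have "emeasure (run_measure A w) X > 0" by simp
  then show ?thesis by (simp add: emeasure_eq_measure)
qed

text \<open>Following edges that attain the Bellman equation defines the word and the run at once.
  Along this run \<open>v\<close> is a potential with equality at every step.\<close>

lemma greedy_run_exists:
  fixes v :: "nat \<Rightarrow> real"
  assumes A: "pwa_valid A" and lam: "0 < lam" "lam < 1"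
    and v: "\<And>q. q < pwa_n A \<Longrightarrow>
      \<exists>a<pwa_k A. \<exists>q'<pwa_n A. 0 < pwa_delta A q a q' \<and> v q = pwa_gamma A q a q' + lam * v q'"
    and q0: "q0 < pwa_n A" "0 < pwa_init A q0"
  obtains w r where "sset w \<subseteq> {..<pwa_k A}" "legal_run A w r" "Disc lam (run_weights A w r) = v q0"
proof -
  obtain a s where as: "\<And>q. q < pwa_n A \<Longrightarrow> a q < pwa_k A \<and> s q < pwa_n A \<and> 0 < pwa_delta A q (a q) (s q)
      \<and> v q = pwa_gamma A q (a q) (s q) + lam * v (s q)"
    using v by metis
  define x where "x i = (s ^^ i) q0" for i
  have x: "x i < pwa_n A" "x 0 = q0" "x (Suc i) = s (x i)" for i
  proof -
    show "x i < pwa_n A"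
      by (induction i) (auto simp: x_def q0 as)
  qed (simp_all add: x_def)
  define w where "w = to_stream (\<lambda>i. a (x i))"
  define r where "r = to_stream x"
  have wr: "w !! i = a (x i)" "r !! i = x i" for i
    by (simp_all add: w_def r_def to_stream_def)
  show thesis
  proof (rule that[of w r])
    show "sset w \<subseteq> {..<pwa_k A}"
      using as[OF x(1)] by (auto simp: sset_range wr)
    show "legal_run A w r"
      unfolding legal_run_def wr x(2,3) using as[OF x(1)] q0 by auto
    obtain B where B: "\<And>q a q'. \<bar>pwa_gamma A q a q'\<bar> \<le> B" by (rule pwa_gamma_bounded[of A]) blast
    have "\<bar>v (x i)\<bar> \<le> (\<Sum>q<pwa_n A. \<bar>v q\<bar>)" for i
      by (intro member_le_sum[of _ _ "\<lambda>q. \<bar>v q\<bar>"]) (auto simp: x(1))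
    then have "Disc lam (run_weights A w r) = v (x 0)"
      using B as[OF x(1)] by (intro Disc_eq_potential[OF lam, of _ B "\<lambda>i. v (x i)"]) (auto simp: run_weights_def wr x(3))
    then show "Disc lam (run_weights A w r) = v q0" by (simp add: x(2))
  qed
qed

text \<open>Along a legal run the values \<open>v (r !! i)\<close> form a bounded potential.\<close>

lemma Disc_legal_run_le:
  fixes v :: "nat \<Rightarrow> real"
  assumes A: "pwa_valid A" and lam: "0 < lam" "lam < 1" and w: "sset w \<subseteq> {..<pwa_k A}"
    and v: "\<And>q a q'. \<lbrakk>q < pwa_n A; a < pwa_k A; q' < pwa_n A; 0 < pwa_delta A q a q'\<rbrakk>
      \<Longrightarrow> pwa_gamma A q a q' + lam * v q' \<le> v q"
    and r: "legal_run A w r"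
  shows "Disc lam (run_weights A w r) \<le> v (r !! 0)"
proof -
  note r_states = legal_run_states[OF A r]
  obtain B where B: "\<And>q a q'. \<bar>pwa_gamma A q a q'\<bar> \<le> B" by (rule pwa_gamma_bounded[of A]) blast
  have "w !! i < pwa_k A" for i
    using w by (auto simp: sset_range)
  moreover have "\<bar>v (r !! i)\<bar> \<le> (\<Sum>q<pwa_n A. \<bar>v q\<bar>)" for i
    by (intro member_le_sum[of _ _ "\<lambda>q. \<bar>v q\<bar>"]) (auto simp: r_states)
  ultimately show ?thesis
    using B v r r_states
    by (intro Disc_le_potential[OF lam, of _ B "\<lambda>i. v (r !! i)" "\<Sum>q<pwa_n A. \<bar>v q\<bar>"])
       (auto simp: run_weights_def legal_run_def)
qed

lemma Disc_legal_run_ge: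
  fixes v :: "nat \<Rightarrow> real"
  assumes A: "pwa_valid A" and lam: "0 < lam" "lam < 1" and w: "sset w \<subseteq> {..<pwa_k A}"
    and v: "\<And>q a q'. \<lbrakk>q < pwa_n A; a < pwa_k A; q' < pwa_n A; 0 < pwa_delta A q a q'\<rbrakk>
      \<Longrightarrow> v q \<le> pwa_gamma A q a q' + lam * v q'"
    and r: "legal_run A w r"
  shows "v (r !! 0) \<le> Disc lam (run_weights A w r)"
proof -
  note r_states = legal_run_states[OF A r]
  obtain B where B: "\<And>q a q'. \<bar>pwa_gamma A q a q'\<bar> \<le> B" by (rule pwa_gamma_bounded[of A]) blast
  have wk: "w !! i < pwa_k A" for i
    using w by (auto simp: sset_range)
  have vb: "\<bar>- v (r !! i)\<bar> \<le> (\<Sum>q<pwa_n A. \<bar>v q\<bar>)" for i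
    by (simp, intro member_le_sum[of _ _ "\<lambda>q. \<bar>v q\<bar>"]) (auto simp: r_states)
  have "- run_weights A w r i + lam * - v (r !! Suc i) \<le> - v (r !! i)" for i
    using v[OF r_states wk r_states, of i i "Suc i"] r by (auto simp: run_weights_def legal_run_def)
  then have "Disc lam (\<lambda>i. - run_weights A w r i) \<le> - v (r !! 0)"
    using B vb by (intro Disc_le_potential[OF lam, of _ B "\<lambda>i. - v (r !! i)"]) (auto simp: run_weights_def)
  then show ?thesis
    using Disc_uminus[OF lam, of "run_weights A w r" B] B by (simp add: run_weights_def)
qed

lemma abs_Disc_run_weights_bounded:
  assumes lam: "0 < lam" "lam < 1"
  obtains K where "\<And>w r. \<bar>Disc lam (run_weights A w r)\<bar> \<le> K"
proof -
  obtain B where B: "\<And>q a q'. \<bar>pwa_gamma A q a q'\<bar> \<le> B" by (rule pwa_gamma_bounded[of A]) blast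
  show thesis
    by (rule that[of "B / (1 - lam)"], rule abs_Disc_le[OF lam]) (simp add: run_weights_def B)
qed

text \<open>The suprema in \<open>L_pos\<close> and \<open>L_as\<close> are taken over the reals and
  are meaningful only for nonempty bounded sets: \<open>- K\<close> belongs to both sets of
  thresholds, and \<open>K\<close> bounds them.\<close>

lemma Disc_level_sets_bounded:
  assumes A: "pwa_valid A" and w: "sset w \<subseteq> {..<pwa_k A}" and K: "\<And>r. \<bar>Disc lam (run_weights A w r)\<bar> \<le> K"
  shows "measure (run_measure A w) {r \<in> space (run_measure A w). - K \<le> Disc lam (run_weights A w r)} = 1"
    and "0 < measure (run_measure A w) {r \<in> space (run_measure A w). \<eta> \<le> Disc lam (run_weights A w r)} \<Longrightarrow> \<eta> \<le> K"
proof -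
  interpret prob_space "run_measure A w" by (rule run_measure_props[OF A w])
  have "- K \<le> Disc lam (run_weights A w r)" for r
    using K[of r] by linarith
  then show "measure (run_measure A w) {r \<in> space (run_measure A w). - K \<le> Disc lam (run_weights A w r)} = 1"
    by (simp add: prob_space)
  assume pos: "0 < measure (run_measure A w) {r \<in> space (run_measure A w). \<eta> \<le> Disc lam (run_weights A w r)}"
  have "{r \<in> space (run_measure A w). \<eta> \<le> Disc lam (run_weights A w r)} \<noteq> {}"
    using pos by (metis less_irrefl measure_empty)
  then obtain r where "\<eta> \<le> Disc lam (run_weights A w r)" by blast
  then show "\<eta> \<le> K" using K[of r] by linarith
qed

text \<open>No word can beat the best initial state, since almost every run is bounded by
  \<open>v\<close> at its start. Conversely, the greedy run from a good initial state tells which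
  word to read.\<close>

lemma pos_disc_iff_optimal_value:
  fixes v :: "nat \<Rightarrow> real"
  assumes A: "pwa_valid A" and lam: "0 < lam" "lam < 1"
    and upper: "\<And>q a q'. \<lbrakk>q < pwa_n A; a < pwa_k A; q' < pwa_n A; 0 < pwa_delta A q a q'\<rbrakk>
      \<Longrightarrow> pwa_gamma A q a q' + lam * v q' \<le> v q"
    and attained: "\<And>q. q < pwa_n A \<Longrightarrow>
      \<exists>a<pwa_k A. \<exists>q'<pwa_n A. 0 < pwa_delta A q a q' \<and> v q = pwa_gamma A q a q' + lam * v q'"
  shows "(\<exists>w. sset w \<subseteq> {..<pwa_k A} \<and> \<nu> \<le> L_pos A lam w) \<longleftrightarrow> (\<exists>q<pwa_n A. 0 < pwa_init A q \<and> \<nu> \<le> v q)"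
proof
  obtain K where K: "\<And>w r. \<bar>Disc lam (run_weights A w r)\<bar> \<le> K"
    using abs_Disc_run_weights_bounded[OF lam, of A] by blast
  {
    assume "\<exists>w. sset w \<subseteq> {..<pwa_k A} \<and> \<nu> \<le> L_pos A lam w"
    then obtain w where w: "sset w \<subseteq> {..<pwa_k A}" and nu: "\<nu> \<le> L_pos A lam w" by blast
    interpret prob_space "run_measure A w" by (rule run_measure_props[OF A w])
    let ?I = "{q. q < pwa_n A \<and> 0 < pwa_init A q}"
    have "?I \<noteq> {}"
    proof
      assume "?I = {}"
      then have "pwa_init A q \<le> 0" if "q < pwa_n A" for q
        using that leI by blast
      then have "(\<Sum>q<pwa_n A. pwa_init A q) \<le> 0"
        by (intro sum_nonpos) simp
      then show False using pwa_valid_init(3)[OF A] by simp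
    qed
    then obtain q where q: "q \<in> ?I" "\<And>p. p \<in> ?I \<Longrightarrow> v p \<le> v q"
      using exists_arg_max[of ?I v] by auto
    have "L_pos A lam w \<le> v q"
      unfolding L_pos_def
    proof (rule cSup_least)
      show "{\<eta>. measure (run_measure A w) {r \<in> space (run_measure A w). \<eta> \<le> Disc lam (run_weights A w r)} > 0} \<noteq> {}"
      proof -
        have "0 < prob {r \<in> space (run_measure A w). - K \<le> Disc lam (run_weights A w r)}"
          using Disc_level_sets_bounded(1)[OF A w K] by simp
        then show ?thesis by blast
      qed
      fix \<eta> assume "\<eta> \<in> {\<eta>. measure (run_measure A w) {r \<in> space (run_measure A w). \<eta> \<le> Disc lam (run_weights A w r)} > 0}"
      then have pos: "measure (run_measure A w) {r \<in> space (run_measure A w). \<eta> \<le> Disc lam (run_weights A w r)} > 0"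
        by simp
      show "\<eta> \<le> v q"
      proof (rule ccontr)
        assume "\<not> \<eta> \<le> v q"
        have "AE r in run_measure A w. \<not> \<eta> \<le> Disc lam (run_weights A w r)"
          using AE_legal_run[OF A w]
        proof eventually_elim
          case (elim r)
          have "r !! 0 \<in> ?I"
            using elim legal_run_states[OF A elim, of 0] by (auto simp: legal_run_def)
          then show ?case
            using Disc_legal_run_le[OF A lam w upper elim] q(2) \<open>\<not> \<eta> \<le> v q\<close> by fastforce
        qed
        then have "{r \<in> space (run_measure A w). \<eta> \<le> Disc lam (run_weights A w r)} \<in> null_sets (run_measure A w)"
          by (subst (asm) AE_iff_null[OF _]) (auto simp: run_measure_Disc_sets[OF A w])
        then show False using pos by (simp add: measure_def null_setsD1)
      qed
    qed
    with nu q(1) show "\<exists>q<pwa_n A. 0 < pwa_init A q \<and> \<nu> \<le> v q" by auto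
  }
  assume "\<exists>q<pwa_n A. 0 < pwa_init A q \<and> \<nu> \<le> v q"
  then obtain q where q: "q < pwa_n A" "0 < pwa_init A q" "\<nu> \<le> v q" by blast
  obtain w r where w: "sset w \<subseteq> {..<pwa_k A}" and r: "legal_run A w r" "Disc lam (run_weights A w r) = v q"
    using greedy_run_exists[OF A lam attained q(1,2)] by metis
  have "v q \<le> L_pos A lam w"
  \<comment> \<open>The threshold \<open>v q\<close> itself may be reached with probability zero;
    only \<open>v q - e\<close> is certain to be reached with positive probability.\<close>
  proof (rule field_le_epsilon)
    fix e :: real assume "0 < e"
    have "v q - e \<le> L_pos A lam w"
      unfolding L_pos_def
    proof (rule cSup_upper)
      show "v q - e \<in> {\<eta>. measure (run_measure A w) {r \<in> space (run_measure A w). \<eta> \<le> Disc lam (run_weights A w r)} > 0}"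
        using Disc_near_legal_run_pos[OF A w lam r(1) \<open>0 < e\<close> run_measure_Disc_sets(1)[OF A w]] r(2)
          run_measure_props(1)[OF A w, THEN sets_eq_imp_space_eq]
        by (force simp: space_stream_space)
      show "bdd_above {\<eta>. measure (run_measure A w) {r \<in> space (run_measure A w). \<eta> \<le> Disc lam (run_weights A w r)} > 0}"
        by (rule bdd_aboveI[of _ K]) (use Disc_level_sets_bounded(2)[OF A w K] in blast)
    qed
    then show "v q \<le> L_pos A lam w + e" by simp
  qed
  then show "\<exists>w. sset w \<subseteq> {..<pwa_k A} \<and> \<nu> \<le> L_pos A lam w"
    using w q(3) by (intro exI[of _ w]) auto
qed

text \<open>Legal runs are bounded below by \<open>v\<close> at their start. If an initial state has
  too small a value, the word read by its minimal run fails: runs close to the minimal one have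
  positive probability and violate every larger threshold.\<close>

lemma as_disc_iff_optimal_value:
  fixes v :: "nat \<Rightarrow> real"
  assumes A: "pwa_valid A" and lam: "0 < lam" "lam < 1"
    and lower: "\<And>q a q'. \<lbrakk>q < pwa_n A; a < pwa_k A; q' < pwa_n A; 0 < pwa_delta A q a q'\<rbrakk>
      \<Longrightarrow> v q \<le> pwa_gamma A q a q' + lam * v q'"
    and attained: "\<And>q. q < pwa_n A \<Longrightarrow>
      \<exists>a<pwa_k A. \<exists>q'<pwa_n A. 0 < pwa_delta A q a q' \<and> v q = pwa_gamma A q a q' + lam * v q'"
  shows "(\<forall>w. sset w \<subseteq> {..<pwa_k A} \<longrightarrow> \<nu> \<le> L_as A lam w) \<longleftrightarrow> (\<forall>q<pwa_n A. 0 < pwa_init A q \<longrightarrow> \<nu> \<le> v q)"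
proof
  obtain K where K: "\<And>w r. \<bar>Disc lam (run_weights A w r)\<bar> \<le> K"
    using abs_Disc_run_weights_bounded[OF lam, of A] by blast
  {
    assume nu: "\<forall>q<pwa_n A. 0 < pwa_init A q \<longrightarrow> \<nu> \<le> v q"
    show "\<forall>w. sset w \<subseteq> {..<pwa_k A} \<longrightarrow> \<nu> \<le> L_as A lam w"
    proof (intro allI impI)
      fix w assume w: "sset w \<subseteq> {..<pwa_k A}"
      interpret prob_space "run_measure A w" by (rule run_measure_props[OF A w])
      have "AE r in run_measure A w. \<nu> \<le> Disc lam (run_weights A w r)"
        using AE_legal_run[OF A w]
      proof eventually_elim
        case (elim r)
        then show ?case
          using Disc_legal_run_ge[OF A lam w lower elim] nu legal_run_states[OF A elim, of 0]
          by (force simp: legal_run_def)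
      qed
      then have "prob {r \<in> space (run_measure A w). \<nu> \<le> Disc lam (run_weights A w r)} = 1"
        using run_measure_Disc_sets(1)[OF A w] by (subst prob_Collect_eq_1) auto
      then show "\<nu> \<le> L_as A lam w"
        unfolding L_as_def
        by (intro cSup_upper bdd_aboveI[of _ K]) (use Disc_level_sets_bounded(2)[OF A w K] in force)+
    qed
  }
  assume nu: "\<forall>w. sset w \<subseteq> {..<pwa_k A} \<longrightarrow> \<nu> \<le> L_as A lam w"
  show "\<forall>q<pwa_n A. 0 < pwa_init A q \<longrightarrow> \<nu> \<le> v q"
  proof (intro allI impI, rule ccontr)
    fix q assume q: "q < pwa_n A" "0 < pwa_init A q" "\<not> \<nu> \<le> v q"
    obtain w r where w: "sset w \<subseteq> {..<pwa_k A}" and r: "legal_run A w r" "Disc lam (run_weights A w r) = v q"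
      using greedy_run_exists[OF A lam attained q(1,2)] by metis
    interpret prob_space "run_measure A w" by (rule run_measure_props[OF A w])
    \<comment> \<open>The midpoint leaves room on both sides: the runs near \<open>r\<close> stay
      below \<open>\<theta>\<close>, and \<open>\<theta>\<close> stays strictly below
      \<open>\<nu>\<close>.\<close>
    define \<theta> where "\<theta> = (v q + \<nu>) / 2"
    have th: "v q < \<theta>" "\<theta> < \<nu>" using q(3) by (auto simp: \<theta>_def)
    have less: "0 < prob {r \<in> space (run_measure A w). Disc lam (run_weights A w r) < \<theta>}"
      using Disc_near_legal_run_pos[OF A w lam r(1) _ run_measure_Disc_sets(2)[OF A w], of "\<theta> - v q"] r(2) th(1)
        run_measure_props(1)[OF A w, THEN sets_eq_imp_space_eq]
      by (force simp: space_stream_space)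
    have "L_as A lam w \<le> \<theta>"
      unfolding L_as_def
    proof (rule cSup_least)
      show "{\<eta>. prob {r \<in> space (run_measure A w). \<eta> \<le> Disc lam (run_weights A w r)} = 1} \<noteq> {}"
        using Disc_level_sets_bounded(1)[OF A w K] by blast
      fix \<eta> assume "\<eta> \<in> {\<eta>. prob {r \<in> space (run_measure A w). \<eta> \<le> Disc lam (run_weights A w r)} = 1}"
      then have "AE r in run_measure A w. \<eta> \<le> Disc lam (run_weights A w r)"
        using run_measure_Disc_sets(1)[OF A w] by (subst (asm) mem_Collect_eq, subst (asm) prob_Collect_eq_1) auto
      moreover have "\<not> (AE r in run_measure A w. \<not> Disc lam (run_weights A w r) < \<theta>)"
        using less run_measure_Disc_sets(2)[OF A w] prob_Collect_eq_0[of "\<lambda>r. Disc lam (run_weights A w r) < \<theta>"] by auto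
      ultimately show "\<eta> \<le> \<theta>"
        by (auto elim: contrapos_np eventually_mono)
    qed
    then show False using nu w th(2) by fastforce
  qed
qed

section \<open>Deciding coded instances\<close>

definition code_init :: "nat \<Rightarrow> nat \<Rightarrow> rat" where
  "code_init x q = dec_rat (code_nth (code_nth x 2) q)"

definition code_entry :: "nat \<Rightarrow> nat \<Rightarrow> nat \<Rightarrow> nat \<Rightarrow> rat" where
  "code_entry y q a q' = dec_rat (code_nth (code_nth (code_nth y q) a) q')"

definition wf_table :: "nat \<Rightarrow> nat \<Rightarrow> nat \<Rightarrow> bool" where
  "wf_table n k y \<longleftrightarrow> code_length y = n \<and> (\<forall>q<n. code_length (code_nth y q) = k \<and>
     (\<forall>a<k. code_length (code_nth (code_nth y q) a) = n \<and>
       (\<forall>q'<n. is_rat (code_nth (code_nth (code_nth y q) a) q'))))"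

text \<open>Positions 0 to 6 hold the number of states, the alphabet size, the initial distribution,
  the transition table, the weight table, the discount factor and the threshold. The conditions
  transfer \<open>pwa_valid\<close> to codes and add that every rational is coded in lowest
  terms.\<close>

definition valid_code :: "nat \<Rightarrow> bool" where
  "valid_code x \<longleftrightarrow> code_length x = 7 \<and>
     code_length (code_nth x 2) = code_nth x 0 \<and>
     (\<forall>q<code_nth x 0. is_rat (code_nth (code_nth x 2) q) \<and> 0 \<le> code_init x q) \<and>
     (\<Sum>q<code_nth x 0. code_init x q) = 1 \<and>
     wf_table (code_nth x 0) (code_nth x 1) (code_nth x 3) \<and>
     (\<forall>q<code_nth x 0. \<forall>a<code_nth x 1.
        (\<forall>q'<code_nth x 0. 0 \<le> code_entry (code_nth x 3) q a q') \<and>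
        (\<Sum>q'<code_nth x 0. code_entry (code_nth x 3) q a q') = 1) \<and>
     wf_table (code_nth x 0) (code_nth x 1) (code_nth x 4) \<and>
     is_rat (code_nth x 5) \<and> is_rat (code_nth x 6) \<and>
     0 < dec_rat (code_nth x 5) \<and> dec_rat (code_nth x 5) < 1"

lemma enc_rl_decode:
  assumes "\<And>i. i < code_length y \<Longrightarrow> is_rat (code_nth y i)"
  shows "enc_rl (map dec_rat (list_decode y)) = y"
proof -
  have "map (enc_rat \<circ> dec_rat) (list_decode y) = list_decode y"
    using assms by (intro map_idI) (auto simp: in_set_conv_nth code_length_list_decode code_nth_list_decode intro!: enc_dec_rat)
  then show ?thesis by (simp add: enc_rl_def)
qed

lemma enc_rl_nth:
  "code_length (enc_rl xs) = length xs"
  "i < length xs \<Longrightarrow> code_nth (enc_rl xs) i = enc_rat (xs ! i)"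
  by (simp_all add: enc_rl_def code_length code_nth)

lemma enc_rlll_nth:
  "code_length (enc_rlll d) = length d"
  "q < length d \<Longrightarrow> code_length (code_nth (enc_rlll d) q) = length (d ! q)"
  "q < length d \<Longrightarrow> a < length (d ! q) \<Longrightarrow> code_nth (code_nth (enc_rlll d) q) a = enc_rl (d ! q ! a)"
  by (simp_all add: enc_rlll_def code_length code_nth)

lemma wf_table_enc_rlll:
  assumes "length d = n" "\<forall>q<n. length (d ! q) = k \<and> (\<forall>a<k. length (d ! q ! a) = n)"
  shows "wf_table n k (enc_rlll d)"
    and "q < n \<Longrightarrow> a < k \<Longrightarrow> q' < n \<Longrightarrow> code_entry (enc_rlll d) q a q' = d ! q ! a ! q'"
  using assms by (auto simp: wf_table_def code_entry_def enc_rlll_nth enc_rl_nth)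

text \<open>Every number codes a list, so lengths and properly coded rational entries are all that
  has to be checked for a number to be the code of a table.\<close>

lemma wf_table_decode:
  assumes "wf_table n k y"
  obtains d where "y = enc_rlll d" "length d = n" "\<forall>q<n. length (d ! q) = k \<and> (\<forall>a<k. length (d ! q ! a) = n)"
proof
  let ?d = "map (\<lambda>r. map (\<lambda>s. map dec_rat (list_decode s)) (list_decode r)) (list_decode y)"
  note simps = code_length_list_decode code_nth_list_decode
  show len: "length ?d = n"
    using assms by (simp add: wf_table_def simps)
  show "\<forall>q<n. length (?d ! q) = k \<and> (\<forall>a<k. length (?d ! q ! a) = n)"
  proof (intro allI impI conjI)
    fix q assume q: "q < n"
    have r: "list_decode y ! q = code_nth y q"
      using q len by (simp add: simps)
    show k: "length (?d ! q) = k"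
      using assms q len by (simp add: r wf_table_def code_length_list_decode[symmetric])
    fix a assume a: "a < k"
    have "list_decode (code_nth y q) ! a = code_nth (code_nth y q) a"
      using a k q len by (intro code_nth_list_decode[symmetric]) (simp add: r code_length_list_decode)
    then show "length (?d ! q ! a) = n"
      using assms q a k len by (simp add: r wf_table_def code_length_list_decode[symmetric])
  qed
  have "list_encode (map (\<lambda>s. enc_rl (map dec_rat (list_decode s))) (list_decode r)) = r" if "r \<in> set (list_decode y)" for r
  proof -
    obtain q where "q < length (list_decode y)" "list_decode y ! q = r"
      using \<open>r \<in> set (list_decode y)\<close> unfolding in_set_conv_nth by blast
    then have q: "q < n" "r = list_decode y ! q"
      using len by simp_all
    have "enc_rl (map dec_rat (list_decode s)) = s" if "s \<in> set (list_decode r)" for s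
    proof -
      obtain a where a: "a < length (list_decode r)" "s = list_decode r ! a"
        using \<open>s \<in> set (list_decode r)\<close> by (auto simp: in_set_conv_nth)
      have "code_nth y q = r" "code_nth r a = s"
        using q a len by (simp_all add: code_nth_list_decode code_length_list_decode)
      moreover have "a < k" "code_length y = n"
        using assms q a \<open>code_nth y q = r\<close> by (auto simp: wf_table_def code_length_list_decode)
      ultimately show ?thesis
        using assms q(1) by (intro enc_rl_decode) (auto simp: wf_table_def)
    qed
    then have "map (\<lambda>s. enc_rl (map dec_rat (list_decode s))) (list_decode r) = list_decode r"
      by (intro map_idI) auto
    then show ?thesis by simp
  qed
  then have "map (\<lambda>r. list_encode (map (\<lambda>s. enc_rl (map dec_rat (list_decode s))) (list_decode r))) (list_decode y) = list_decode y"
    by (intro map_idI) auto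
  then show "y = enc_rlll ?d"
    by (simp add: enc_rlll_def comp_def)
qed

text \<open>This interface hides the list encoding from the later arguments. Agreement is only
  demanded within range, where decoding is meaningful.\<close>

definition represents :: "nat \<Rightarrow> pwa \<Rightarrow> rat \<Rightarrow> rat \<Rightarrow> bool" where
  "represents x A lam nu \<longleftrightarrow> code_nth x 0 = pwa_n A \<and> code_nth x 1 = pwa_k A \<and>
     dec_rat (code_nth x 5) = lam \<and> dec_rat (code_nth x 6) = nu \<and>
     (\<forall>q<pwa_n A. pwa_init A q = of_rat (code_init x q)) \<and>
     (\<forall>q<pwa_n A. \<forall>a<pwa_k A. \<forall>q'<pwa_n A. pwa_delta A q a q' = of_rat (code_entry (code_nth x 3) q a q') \<and>
        pwa_gamma A q a q' = of_rat (code_entry (code_nth x 4) q a q'))"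

lemma enc_instance_nth:
  assumes "x = enc_instance (n, k, i, d, g) lam nu"
  shows "code_length x = 7" "code_nth x 0 = n" "code_nth x 1 = k" "code_nth x 2 = enc_rl i"
    "code_nth x 3 = enc_rlll d" "code_nth x 4 = enc_rlll g" "code_nth x 5 = enc_rat lam" "code_nth x 6 = enc_rat nu"
  using code_length[of "[n, k, enc_rl i, enc_rlll d, enc_rlll g, enc_rat lam, enc_rat nu]"]
    code_nth[of _ "[n, k, enc_rl i, enc_rlll d, enc_rlll g, enc_rat lam, enc_rat nu]"]
  by (simp_all add: assms del: list_encode.simps)

lemma enc_instance_valid_code:
  assumes x: "x = enc_instance A lam nu" and A: "pwa_valid A" and lam: "0 < lam" "lam < 1"
  shows "valid_code x" "represents x A lam nu"
proof -
  obtain n k i d g where A_eq: "A = (n, k, i, d, g)" by (cases A)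
  note nth = enc_instance_nth[OF x[unfolded A_eq]]
  have i: "length i = n" and d: "length d = n" "\<forall>q<n. length (d ! q) = k \<and> (\<forall>a<k. length (d ! q ! a) = n)"
    and g: "length g = n" "\<forall>q<n. length (g ! q) = k \<and> (\<forall>a<k. length (g ! q ! a) = n)"
    using A by (auto simp: A_eq)
  note table = wf_table_enc_rlll[OF d] wf_table_enc_rlll[OF g]
  have init: "code_init x q = i ! q" if "q < n" for q
    using that i by (simp add: code_init_def nth enc_rl_nth)
  show "valid_code x"
    using A lam unfolding valid_code_def nth by (simp add: A_eq init table i enc_rl_nth)
  show "represents x A lam nu"
    unfolding represents_def nth by (simp add: A_eq init table)
qed

lemma valid_code_is_instance:
  assumes "valid_code x"
  shows "\<exists>A lam nu. x = enc_instance A lam nu \<and> pwa_valid A \<and> 0 < lam \<and> lam < 1"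
proof -
  define n where "n = code_nth x 0"
  define k where "k = code_nth x 1"
  define i where "i = map dec_rat (list_decode (code_nth x 2))"
  have v: "code_length x = 7" "code_length (code_nth x 2) = n"
    "\<And>q. q < n \<Longrightarrow> is_rat (code_nth (code_nth x 2) q)" "wf_table n k (code_nth x 3)"
    "wf_table n k (code_nth x 4)" "is_rat (code_nth x 5)" "is_rat (code_nth x 6)"
    using assms by (auto simp: valid_code_def n_def k_def)
  have i: "enc_rl i = code_nth x 2"
    unfolding i_def by (rule enc_rl_decode) (simp add: v(2,3))
  have i_len: "length i = n"
    using v(2) by (simp add: i_def code_length_list_decode)
  obtain d where d: "code_nth x 3 = enc_rlll d" "length d = n" "\<forall>q<n. length (d ! q) = k \<and> (\<forall>a<k. length (d ! q ! a) = n)"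
    using wf_table_decode[OF v(4)] by metis
  obtain g where g: "code_nth x 4 = enc_rlll g" "length g = n" "\<forall>q<n. length (g ! q) = k \<and> (\<forall>a<k. length (g ! q ! a) = n)"
    using wf_table_decode[OF v(5)] by metis
  let ?l = "[n, k, enc_rl i, enc_rlll d, enc_rlll g, enc_rat (dec_rat (code_nth x 5)), enc_rat (dec_rat (code_nth x 6))]"
  have "list_decode x = map (code_nth x) [0..<7]"
    using v(1) by (intro nth_equalityI) (auto simp: code_length_list_decode code_nth_list_decode)
  also have "\<dots> = [code_nth x 0, code_nth x 1, code_nth x 2, code_nth x 3, code_nth x 4, code_nth x 5, code_nth x 6]"
    by (simp add: upt_rec eval_nat_numeral)
  also have "\<dots> = ?l"
    using v by (simp add: i d(1)[symmetric] g(1)[symmetric] enc_dec_rat n_def k_def)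
  finally have "x = list_encode ?l"
    by (metis list_decode_inverse)
  then have x: "x = enc_instance (n, k, i, d, g) (dec_rat (code_nth x 5)) (dec_rat (code_nth x 6))"
    by simp
  note table = wf_table_enc_rlll[OF d(2,3)]
  have init: "code_init x q = i ! q" if "q < n" for q
    using that i_len by (simp add: code_init_def i[symmetric] enc_rl_nth)
  have "pwa_valid (n, k, i, d, g)"
    using assms i_len d g unfolding valid_code_def n_def[symmetric] k_def[symmetric]
    by (simp add: init table)
  then show ?thesis
    using x assms unfolding valid_code_def by blast
qed

text \<open>\<open>s = 1\<close> is the optimality equation for maximisation, \<open>s = -1\<close> the one for minimisation.\<close>

definition bellman :: "rat \<Rightarrow> nat \<Rightarrow> nat \<Rightarrow> bool" where
  "bellman s x y \<longleftrightarrow> (\<forall>q<code_nth x 0.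
     (\<forall>a<code_nth x 1. \<forall>q'<code_nth x 0. 0 < code_entry (code_nth x 3) q a q' \<longrightarrow>
        s * (code_entry (code_nth x 4) q a q' + dec_rat (code_nth x 5) * dec_rat (code_nth y q')) \<le> s * dec_rat (code_nth y q)) \<and>
     (\<exists>a<code_nth x 1. \<exists>q'<code_nth x 0. 0 < code_entry (code_nth x 3) q a q' \<and>
        dec_rat (code_nth y q) = code_entry (code_nth x 4) q a q' + dec_rat (code_nth x 5) * dec_rat (code_nth y q')))"

text \<open>The existence result for maximisation is applied to the weights multiplied by
  \<open>s\<close>, and its solution is multiplied by \<open>s\<close> again; as
  \<open>s * s = 1\<close>, this covers both signs.\<close>

lemma bellman_exists:
  assumes x: "valid_code x" and k: "0 < code_nth x 1" and s: "s = 1 \<or> s = -1"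
  shows "\<exists>y. bellman s x y"
proof -
  let ?n = "code_nth x 0" and ?k = "code_nth x 1"
  let ?d = "code_entry (code_nth x 3)" and ?g = "code_entry (code_nth x 4)" and ?lam = "dec_rat (code_nth x 5)"
  \<comment> \<open>An edge is a letter together with a possible successor, so that a positional
    policy fixes both.\<close>
  define E where "E q = {(a, q'). a < ?k \<and> q' < ?n \<and> 0 < ?d q a q'}" for q
  have "finite (E q)" for q
    by (rule finite_subset[of _ "{..<?k} \<times> {..<?n}"]) (auto simp: E_def)
  moreover have "E q \<noteq> {}" if "q < ?n" for q
  proof
    assume "E q = {}"
    have "?d q 0 q' \<le> 0" if "q' < ?n" for q'
      using \<open>E q = {}\<close> k that not_less unfolding E_def by blast
    then have "(\<Sum>q'<?n. ?d q 0 q') \<le> 0"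
      by (intro sum_nonpos) simp
    moreover have "(\<Sum>q'<?n. ?d q 0 q') = 1"
      using x k that by (auto simp: valid_code_def)
    ultimately show False by simp
  qed
  moreover have lam: "0 < ?lam" "?lam < 1"
    using x by (auto simp: valid_code_def)
  ultimately obtain v :: "nat \<Rightarrow> real" where v: "\<forall>q\<in>{..<?n}. v q \<in> \<rat> \<and>
      (\<forall>e\<in>E q. of_rat (s * ?g q (fst e) (snd e)) + of_rat ?lam * v (snd e) \<le> v q) \<and>
      (\<exists>e\<in>E q. v q = of_rat (s * ?g q (fst e) (snd e)) + of_rat ?lam * v (snd e))"
    using bellman_solution_exists[of "{..<?n}" E snd "\<lambda>q e. of_rat (s * ?g q (fst e) (snd e))" "of_rat ?lam"]
    by (auto simp: E_def)
  then have "\<forall>q\<in>{..<?n}. \<exists>r. v q = of_rat r"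
    by (meson Rats_cases)
  then obtain r where r: "\<And>q. q < ?n \<Longrightarrow> v q = of_rat (r q)"
    by (metis lessThan_iff)
  define y where "y = list_encode (map (\<lambda>q. enc_rat (s * r q)) [0..<?n])"
  have y: "dec_rat (code_nth y q) = s * r q" if "q < ?n" for q
    using that by (simp add: y_def code_nth)
  have ss: "s * (s * t) = t" for t
    using s by auto
  have "(\<forall>a<?k. \<forall>q'<?n. 0 < ?d q a q' \<longrightarrow> s * ?g q a q' + ?lam * r q' \<le> r q) \<and>
      (\<exists>a<?k. \<exists>q'<?n. 0 < ?d q a q' \<and> r q = s * ?g q a q' + ?lam * r q')" if q: "q < ?n" for q
  proof
    show "\<forall>a<?k. \<forall>q'<?n. 0 < ?d q a q' \<longrightarrow> s * ?g q a q' + ?lam * r q' \<le> r q"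
    proof (intro allI impI)
      fix a q' assume *: "a < ?k" "q' < ?n" "0 < ?d q a q'"
      then have "(a, q') \<in> E q" by (simp add: E_def)
      with v q have "of_rat (s * ?g q a q') + of_rat ?lam * v q' \<le> v q" by fastforce
      then have "(of_rat (s * ?g q a q' + ?lam * r q') :: real) \<le> of_rat (r q)"
        using q * by (simp add: r of_rat_add of_rat_mult)
      then show "s * ?g q a q' + ?lam * r q' \<le> r q"
        by (simp only: of_rat_less_eq)
    qed
    obtain a q' where *: "a < ?k" "q' < ?n" "0 < ?d q a q'" "v q = of_rat (s * ?g q a q') + of_rat ?lam * v q'"
    proof -
      obtain e where "e \<in> E q" "v q = of_rat (s * ?g q (fst e) (snd e)) + of_rat ?lam * v (snd e)"
        using v q by blast
      then show thesis
        by (intro that[of "fst e" "snd e"]) (auto simp: E_def)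
    qed
    then have "(of_rat (r q) :: real) = of_rat (s * ?g q a q' + ?lam * r q')"
      using q by (simp add: r of_rat_add of_rat_mult)
    then have "r q = s * ?g q a q' + ?lam * r q'"
      by (simp only: of_rat_eq_iff)
    with * show "\<exists>a<?k. \<exists>q'<?n. 0 < ?d q a q' \<and> r q = s * ?g q a q' + ?lam * r q'" by blast
  qed
  moreover have "s * (c + ?lam * (s * t)) = s * c + ?lam * t" for c t
    using s by auto
  moreover have "s * t = c + ?lam * (s * t') \<longleftrightarrow> t = s * c + ?lam * t'" for c t t'
    using s by auto
  ultimately have "bellman s x y"
    unfolding bellman_def by (simp add: y ss cong: conj_cong)
  then show ?thesis ..
qed

lemma bellmanD:
  assumes x: "represents x A lam nu" and y: "bellman s x y"
  shows "\<lbrakk>q < pwa_n A; a < pwa_k A; q' < pwa_n A; 0 < pwa_delta A q a q'\<rbrakk> \<Longrightarrow>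
      of_rat s * (pwa_gamma A q a q' + of_rat lam * of_rat (dec_rat (code_nth y q'))) \<le> of_rat s * (of_rat (dec_rat (code_nth y q)) :: real)"
    and "q < pwa_n A \<Longrightarrow> \<exists>a<pwa_k A. \<exists>q'<pwa_n A. 0 < pwa_delta A q a q' \<and>
      of_rat (dec_rat (code_nth y q)) = pwa_gamma A q a q' + of_rat lam * of_rat (dec_rat (code_nth y q'))"
proof -
  assume *: "q < pwa_n A" "a < pwa_k A" "q' < pwa_n A" "0 < pwa_delta A q a q'"
  then have "s * (code_entry (code_nth x 4) q a q' + lam * dec_rat (code_nth y q')) \<le> s * dec_rat (code_nth y q)"
    using x y by (auto simp: represents_def bellman_def)
  then have "(of_rat (s * (code_entry (code_nth x 4) q a q' + lam * dec_rat (code_nth y q'))) :: real) \<le> of_rat (s * dec_rat (code_nth y q))"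
    by (simp only: of_rat_less_eq)
  then show "of_rat s * (pwa_gamma A q a q' + of_rat lam * of_rat (dec_rat (code_nth y q'))) \<le> of_rat s * (of_rat (dec_rat (code_nth y q)) :: real)"
    using x * by (simp add: represents_def of_rat_mult of_rat_add)
next
  assume *: "q < pwa_n A"
  then obtain a q' where **: "a < pwa_k A" "q' < pwa_n A" "0 < code_entry (code_nth x 3) q a q'"
    "dec_rat (code_nth y q) = code_entry (code_nth x 4) q a q' + lam * dec_rat (code_nth y q')"
    using x y unfolding represents_def bellman_def by metis
  have "(of_rat (dec_rat (code_nth y q)) :: real) = pwa_gamma A q a q' + of_rat lam * of_rat (dec_rat (code_nth y q'))"
    unfolding **(4) using x * ** by (simp add: represents_def of_rat_mult of_rat_add)
  then show "\<exists>a<pwa_k A. \<exists>q'<pwa_n A. 0 < pwa_delta A q a q' \<and>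
      of_rat (dec_rat (code_nth y q)) = pwa_gamma A q a q' + of_rat lam * of_rat (dec_rat (code_nth y q'))"
    using x * ** by (intro exI[of _ a] exI[of _ q'] conjI) (auto simp: represents_def)
qed

text \<open>The guard keeps the search total: on other inputs every number qualifies. It excludes
  the empty alphabet because a state without outgoing edges cannot attain the optimality
  equation.\<close>

definition solution :: "rat \<Rightarrow> nat \<Rightarrow> nat" where
  "solution s x = (LEAST y. valid_code x \<and> 0 < code_nth x 1 \<longrightarrow> bellman s x y)"

lemma bellman_solution:
  assumes "valid_code x" "0 < code_nth x 1" "s = 1 \<or> s = -1"
  shows "bellman s x (solution s x)"
  unfolding solution_def using LeastI_ex[OF bellman_exists[OF assms]] assms by simp

lemma sset_neq_empty: "sset w \<noteq> {}"
  by (cases w) auto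

text \<open>There is no infinite word over an empty alphabet, which accounts for the conjunct on
  \<open>code_nth x 1\<close>.\<close>

lemma pos_disc_nonempty_iff:
  "x \<in> pos_disc_nonempty \<longleftrightarrow> valid_code x \<and> 0 < code_nth x 1 \<and>
    (\<exists>q<code_nth x 0. 0 < code_init x q \<and> dec_rat (code_nth x 6) \<le> dec_rat (code_nth (solution 1 x) q))"
proof -
  have main: "(\<exists>w. sset w \<subseteq> {..<pwa_k A} \<and> real_of_rat nu \<le> L_pos A (real_of_rat lam) w) \<longleftrightarrow>
      0 < code_nth x 1 \<and>
      (\<exists>q<code_nth x 0. 0 < code_init x q \<and> dec_rat (code_nth x 6) \<le> dec_rat (code_nth (solution 1 x) q))"
    if A: "x = enc_instance A lam nu" "pwa_valid A" "0 < lam" "lam < 1" for A lam nu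
  proof (cases "pwa_k A = 0")
    case True
    then show ?thesis
      using enc_instance_valid_code(2)[OF A] by (simp add: represents_def sset_neq_empty)
  next
    case False
    have x: "represents x A lam nu" and k: "0 < code_nth x 1"
      using enc_instance_valid_code(2)[OF A] False by (simp_all add: represents_def)
    have "bellman 1 x (solution 1 x)"
      using bellman_solution[OF enc_instance_valid_code(1)[OF A] k] by simp
    from bellmanD[OF x this] have "(\<exists>w. sset w \<subseteq> {..<pwa_k A} \<and> real_of_rat nu \<le> L_pos A (real_of_rat lam) w) \<longleftrightarrow>
        (\<exists>q<pwa_n A. 0 < pwa_init A q \<and> real_of_rat nu \<le> of_rat (dec_rat (code_nth (solution 1 x) q)))"
      using A(2-) by (intro pos_disc_iff_optimal_value) (simp_all add: of_rat_less)
    then show ?thesis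
      using x k by (auto simp: represents_def of_rat_less_eq)
  qed
  show ?thesis (is "_ \<longleftrightarrow> ?R")
  proof
    assume "x \<in> pos_disc_nonempty"
    then obtain A lam nu where A: "x = enc_instance A lam nu" "pwa_valid A" "0 < lam" "lam < 1"
      and "\<exists>w. sset w \<subseteq> {..<pwa_k A} \<and> real_of_rat nu \<le> L_pos A (real_of_rat lam) w"
      unfolding pos_disc_nonempty_def by blast
    then show ?R
      using main[OF A] enc_instance_valid_code(1)[OF A] by simp
  next
    assume R: ?R
    then obtain A lam nu where A: "x = enc_instance A lam nu" "pwa_valid A" "0 < lam" "lam < 1"
      using valid_code_is_instance by blast
    then show "x \<in> pos_disc_nonempty"
      unfolding pos_disc_nonempty_def using main[OF A] R by blast
  qed
qed

text \<open>Over an empty alphabet universality is vacuous, so the alphabet condition appears as a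
  premise here.\<close>

lemma as_disc_universal_iff:
  "x \<in> as_disc_universal \<longleftrightarrow> valid_code x \<and> (0 < code_nth x 1 \<longrightarrow>
    (\<forall>q<code_nth x 0. 0 < code_init x q \<longrightarrow> dec_rat (code_nth x 6) \<le> dec_rat (code_nth (solution (-1) x) q)))"
proof -
  have main: "(\<forall>w. sset w \<subseteq> {..<pwa_k A} \<longrightarrow> real_of_rat nu \<le> L_as A (real_of_rat lam) w) \<longleftrightarrow>
      (0 < code_nth x 1 \<longrightarrow>
      (\<forall>q<code_nth x 0. 0 < code_init x q \<longrightarrow> dec_rat (code_nth x 6) \<le> dec_rat (code_nth (solution (-1) x) q)))"
    if A: "x = enc_instance A lam nu" "pwa_valid A" "0 < lam" "lam < 1" for A lam nu
  proof (cases "pwa_k A = 0")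
    case True
    then show ?thesis
      using enc_instance_valid_code(2)[OF A] by (simp add: represents_def sset_neq_empty)
  next
    case False
    have x: "represents x A lam nu" and k: "0 < code_nth x 1"
      using enc_instance_valid_code(2)[OF A] False by (simp_all add: represents_def)
    have "bellman (-1) x (solution (-1) x)"
      using bellman_solution[OF enc_instance_valid_code(1)[OF A] k] by simp
    note b = bellmanD[OF x this]
    have "of_rat (dec_rat (code_nth (solution (-1) x) q)) \<le> pwa_gamma A q a q' + of_rat lam * of_rat (dec_rat (code_nth (solution (-1) x) q'))"
      if "q < pwa_n A" "a < pwa_k A" "q' < pwa_n A" "0 < pwa_delta A q a q'" for q a q'
      using b(1)[OF that] by (simp only: of_rat_minus of_rat_1 mult_minus1 neg_le_iff_le)
    then have "(\<forall>w. sset w \<subseteq> {..<pwa_k A} \<longrightarrow> real_of_rat nu \<le> L_as A (real_of_rat lam) w) \<longleftrightarrow>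
        (\<forall>q<pwa_n A. 0 < pwa_init A q \<longrightarrow> real_of_rat nu \<le> of_rat (dec_rat (code_nth (solution (-1) x) q)))"
      using A(2-) b(2) by (intro as_disc_iff_optimal_value) (simp_all add: of_rat_less)
    then show ?thesis
      using x k by (auto simp: represents_def of_rat_less_eq)
  qed
  show ?thesis (is "_ \<longleftrightarrow> ?R")
  proof
    assume "x \<in> as_disc_universal"
    then obtain A lam nu where A: "x = enc_instance A lam nu" "pwa_valid A" "0 < lam" "lam < 1"
      and "\<forall>w. sset w \<subseteq> {..<pwa_k A} \<longrightarrow> real_of_rat nu \<le> L_as A (real_of_rat lam) w"
      unfolding as_disc_universal_def by blast
    then show ?R
      using main[OF A] enc_instance_valid_code(1)[OF A] by simp
  next
    assume R: ?R
    then obtain A lam nu where A: "x = enc_instance A lam nu" "pwa_valid A" "0 < lam" "lam < 1"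
      using valid_code_is_instance by blast
    then show "x \<in> as_disc_universal"
      unfolding as_disc_universal_def using main[OF A] R by blast
  qed
qed

section \<open>Computability of the two decision procedures\<close>

lemmas computable_intros = computable_bool_intros computable_nat_intros computable_rat_intros
  computable_bool_is_rat computable_code_nth computable_code_length

lemma computable_bool_valid_code: "computable_bool valid_code"
  unfolding valid_code_def wf_table_def code_init_def code_entry_def
  by (intro computable_intros)

lemma computable_solution: "s = 1 \<or> s = -1 \<Longrightarrow> computable (solution s)"
  unfolding solution_def
proof (rule computable_Least)
  show "computable_bool (\<lambda>z. valid_code (code_fst z) \<and> 0 < code_nth (code_fst z) 1 \<longrightarrow> bellman s (code_fst z) (code_snd z))"
    unfolding bellman_def code_entry_def
    by (intro computable_bool_o[OF computable_bool_valid_code] computable_intros)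
  show "\<exists>y. valid_code x \<and> 0 < code_nth x 1 \<longrightarrow> bellman s x y" if "s = 1 \<or> s = -1" for x
    using bellman_exists[OF _ _ that] by blast
qed

theorem theorem11:
  shows "decidable pos_disc_nonempty \<and> decidable as_disc_universal"
proof
  have sol: "computable (\<lambda>x. solution 1 (f x))" "computable (\<lambda>x. solution (-1) (f x))" if "computable f" for f
    by (intro computable_o[OF computable_solution] that; simp)+
  have "computable_bool (\<lambda>x. x \<in> pos_disc_nonempty)"
    unfolding pos_disc_nonempty_iff code_init_def
    by (intro computable_bool_o[OF computable_bool_valid_code] sol computable_intros)
  then show "decidable pos_disc_nonempty"
    by (simp add: computable_bool_def decidable_computable)
  have "computable_bool (\<lambda>x. x \<in> as_disc_universal)"
    unfolding as_disc_universal_iff code_init_def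
    by (intro computable_bool_o[OF computable_bool_valid_code] sol computable_intros)
  then show "decidable as_disc_universal"
    by (simp add: computable_bool_def decidable_computable)
qed

end
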